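(* Let $\mathbb{K}$ be an algebraically closed field, let $s, n_1,\dots,n_s$ and $d_1,\dots,d_s$ be positive integers, and put $\mathbf{d}=(d_1,\dots,d_s)$, $n:=n_1+\cdots+n_s$ and $d:=d_1+\cdots+d_s$. Assume that $\mathrm{char}(\mathbb{K})=0$ or $\mathrm{char}(\mathbb{K})>d$. Let $\mathbb{P}R_{\mathbf{d}}\simeq\mathbb{P}^r$, $r+1=\prod_{i=1}^s\binom{n_i+d_i}{n_i}$, be the projective space of multihomogeneous polynomials of multidegree $\mathbf{d}$ in $s$ sets of variables, the $j$-th set consisting of $n_j+1$ variables. Then for every $f\in\mathbb{P}R_{\mathbf{d}}$ the cactus rank $cr_{\mathbf{d}}(f)$ of $f$ with respect to the Segre-Veronese variety of multidegree $\mathbf{d}$ satisfies: \begin{itemize} \item if $d$ is even, $d=2k+2$ with $k\ge 0$ an integer, then $cr_{\mathbf{d}}(f)\le\binom{n+k}{k}+\binom{n+k+1}{k+1}$; \item if $d$ is odd, $d=2k+1$ with $k\ge 0$ an integer, then $cr_{\mathbf{d}}(f)\le 2\binom{n+k}{k}$. \end{itemize}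
   Context: Let $R$ be the divided power polynomial ring over $\mathbb{K}$ in the variables $x_{i,j}$, $j=1,\dots,s$, $i=0,\dots,n_j$. For a multidegree $\mathbf{a}=(a_1,\dots,a_s)$, $R_{\mathbf{a}}$ denotes the component of elements that are homogeneous of degree $a_j$ in the $j$-th set of variables $\{x_{i,j}: i=0,\dots,n_j\}$ for every $j$. Since $\mathrm{char}(\mathbb{K})$ is $0$ or larger than $d=d_1+\cdots+d_s$, in total degree at most $d$ one may identify divided powers with ordinary powers via $x^{[a]}=x^a/a!$, so that $R_{\mathbf{d}}$ is the space of ordinary multihomogeneous polynomials of multidegree $\mathbf{d}$. Let $Y=\mathbb{P}^{n_1}\times\cdots\times\mathbb{P}^{n_s}$, where $\mathbb{P}^{n_j}=\mathbb{P}(R_{e_j})$ is the projective space of linear forms in the $j$-th set of variables ($e_j$ is the $j$-th standard basis vector). The Segre-Veronese embedding of multidegree $\mathbf{d}$ is $$\nu_{\mathbf{d}}:Y\to\mathbb{P}R_{\mathbf{d}}=\mathbb{P}^r,\qquad ([\ell_1],\dots,[\ell_s])\mapsto[\ell_1^{[d_1]}\cdots\ell_s^{[d_s]}],$$ i.e. the embedding defined by the line bundle $\mathcal{O}_Y(d_1,\dots,d_s)$. The Segre-Veronese variety is $X:=\nu_{\mathbf{d}}(Y)\subset\mathbb{P}^r$. For a zero-dimensional scheme $Z\subset\mathbb{P}^r$, $\langle Z\rangle$ denotes its linear span, the smallest linear subspace of $\mathbb{P}^r$ containing $Z$ as a subscheme. For $f\in\mathbb{P}^r$, the cactus rank $cr_{\mathbf{d}}(f)$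 is the minimal length (degree) of a zero-dimensional closed subscheme $Z\subset X$ such that $f\in\langle Z\rangle$. *)

theory Defs
  imports
    Complex_Main
    "HOL-Library.Poly_Mapping"
    "HOL-Library.Extended_Nat"
    "HOL-Computational_Algebra.Computational_Algebra"
begin

section \<open>Vectors and projective spaces\<close>

text \<open>
  Finitely supported functions \<^typ>\<open>'v \<Rightarrow>\<^sub>0 'k\<close> serve both as vectors with coordinates indexed by
  \<^typ>\<open>'v\<close> and (with \<^typ>\<open>'v\<close> a type of exponents) as polynomials.
\<close>

definition scale :: "'k::field \<Rightarrow> ('v \<Rightarrow>\<^sub>0 'k) \<Rightarrow> ('v \<Rightarrow>\<^sub>0 'k)" where
  "scale c p = Poly_Mapping.map ((*) c) p"

lemma lookup_scale [simp]: "Poly_Mapping.lookup (scale c p) v = c * Poly_Mapping.lookup p v"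
  by (simp add: scale_def Poly_Mapping.map.rep_eq when_def)

global_interpretation lin: vector_space "scale :: 'k::field \<Rightarrow> ('v \<Rightarrow>\<^sub>0 'k) \<Rightarrow> ('v \<Rightarrow>\<^sub>0 'k)"
  by unfold_locales (auto intro!: poly_mapping_eqI simp: lookup_add algebra_simps)

text \<open>A point of a projective space is a line through the origin.\<close>

type_synonym ('v, 'k) proj_point = "('v \<Rightarrow>\<^sub>0 'k) set"

definition proj_point :: "('v \<Rightarrow>\<^sub>0 'k::field) \<Rightarrow> ('v, 'k) proj_point" where
  "proj_point v = lin.span {v}"

definition projective_space :: "('v \<Rightarrow>\<^sub>0 'k::field) set \<Rightarrow> ('v, 'k) proj_point set" where
  "projective_space U = {proj_point v | v. v \<in> U \<and> v \<noteq> 0}"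

definition coord_space :: "'v set \<Rightarrow> ('v \<Rightarrow>\<^sub>0 'k::zero) set" where
  "coord_space W = {v. Poly_Mapping.keys v \<subseteq> W}"


section \<open>Homogeneous coordinate ring of a projective space\<close>

type_synonym ('v, 'k) mpoly = "('v \<Rightarrow>\<^sub>0 nat) \<Rightarrow>\<^sub>0 'k"

definition total_deg :: "('v \<Rightarrow>\<^sub>0 nat) \<Rightarrow> nat" where
  "total_deg m = (\<Sum>v\<in>Poly_Mapping.keys m. Poly_Mapping.lookup m v)"

definition poly_ring :: "'v set \<Rightarrow> ('v, 'k::zero) mpoly set" where
  "poly_ring W = {F. \<forall>m\<in>Poly_Mapping.keys F. Poly_Mapping.keys m \<subseteq> W}"

definition forms :: "'v set \<Rightarrow> nat \<Rightarrow> ('v, 'k::zero) mpoly set" where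
  "forms W t = {F \<in> poly_ring W. \<forall>m\<in>Poly_Mapping.keys F. total_deg m = t}"

definition hom_component :: "nat \<Rightarrow> ('v, 'k::comm_monoid_add) mpoly \<Rightarrow> ('v, 'k) mpoly" where
  "hom_component t F =
     (\<Sum>m\<in>{m\<in>Poly_Mapping.keys F. total_deg m = t}. Poly_Mapping.single m (Poly_Mapping.lookup F m))"

definition eval_at :: "('v, 'k::comm_semiring_1) mpoly \<Rightarrow> ('v \<Rightarrow>\<^sub>0 'k) \<Rightarrow> 'k" where
  "eval_at F v = (\<Sum>m\<in>Poly_Mapping.keys F. Poly_Mapping.lookup F m *
     (\<Prod>w\<in>Poly_Mapping.keys m. Poly_Mapping.lookup v w ^ Poly_Mapping.lookup m w))"

text \<open>The homogeneous ideal generated by the forms that vanish at all points of \<open>A\<close>.\<close>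

definition vanishing_ideal :: "'v set \<Rightarrow> ('v, 'k::field) proj_point set \<Rightarrow> ('v, 'k) mpoly set" where
  "vanishing_ideal W A =
     {F \<in> poly_ring W. \<forall>t. \<forall>P\<in>A. \<forall>v\<in>P. eval_at (hom_component t F) v = 0}"


section \<open>Zero-dimensional closed subschemes\<close>

definition is_ideal :: "'v set \<Rightarrow> ('v, 'k::comm_ring_1) mpoly set \<Rightarrow> bool" where
  "is_ideal W I \<longleftrightarrow> I \<subseteq> poly_ring W \<and> 0 \<in> I \<and> (\<forall>F\<in>I. \<forall>G\<in>I. F + G \<in> I) \<and>
     (\<forall>F\<in>I. \<forall>G\<in>poly_ring W. G * F \<in> I)"

definition homogeneous_ideal :: "'v set \<Rightarrow> ('v, 'k::comm_ring_1) mpoly set \<Rightarrow> bool" where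
  "homogeneous_ideal W I \<longleftrightarrow> is_ideal W I \<and> (\<forall>F\<in>I. \<forall>t. hom_component t F \<in> I)"

definition saturated :: "'v set \<Rightarrow> ('v, 'k::comm_ring_1) mpoly set \<Rightarrow> bool" where
  "saturated W I \<longleftrightarrow>
     (\<forall>F\<in>poly_ring W. (\<exists>k. \<forall>G\<in>forms W k. G * F \<in> I) \<longrightarrow> F \<in> I)"

text \<open>
  The closed subschemes of \<open>Proj (poly_ring W)\<close>, for finite \<open>W\<close>, correspond bijectively to the
  saturated homogeneous ideals of \<open>poly_ring W\<close>. A closed subscheme is represented by its
  saturated ideal, and inclusion of subschemes is reverse inclusion of ideals; a reduced
  subscheme is represented by the vanishing ideal of its set of points.
\<close>

definition closed_subscheme :: "'v set \<Rightarrow> ('v, 'k::comm_ring_1) mpoly set \<Rightarrow> bool" where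
  "closed_subscheme W Z \<longleftrightarrow> homogeneous_ideal W Z \<and> saturated W Z"

definition hilbert_function :: "'v set \<Rightarrow> ('v, 'k::field) mpoly set \<Rightarrow> nat \<Rightarrow> nat" where
  "hilbert_function W Z t =
     lin.dim (forms W t :: ('v, 'k) mpoly set) - lin.dim (Z \<inter> forms W t)"

text \<open>
  A closed subscheme has dimension at most zero iff its Hilbert polynomial is constant, and this
  constant is then its length. The value \<open>m = 0\<close> belongs to the empty scheme, the ideal of which
  is the whole ring; its linear span is empty.
\<close>

definition zero_dim_subscheme :: "'v set \<Rightarrow> ('v, 'k::field) mpoly set \<Rightarrow> nat \<Rightarrow> bool" where
  "zero_dim_subscheme W Z m \<longleftrightarrow> closed_subscheme W Z \<and>
     (\<exists>t0. \<forall>t\<ge>t0. hilbert_function W Z t = m)"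

text \<open>Points of the intersection of all linear subspaces that contain \<open>Z\<close> as a subscheme.\<close>

definition linear_span :: "'v set \<Rightarrow> ('v, 'k::field) mpoly set \<Rightarrow> ('v, 'k) proj_point set" where
  "linear_span W Z = \<Inter> {projective_space U | U. U \<subseteq> coord_space W \<and> lin.subspace U \<and>
     vanishing_ideal W (projective_space U) \<subseteq> Z}"


section \<open>Multihomogeneous polynomials and Segre-Veronese varieties\<close>

text \<open>The variable \<open>x\<^bsub>i,j\<^esub>\<close>, for \<open>1 \<le> j \<le> s\<close> and \<open>0 \<le> i \<le> n j\<close>, is the pair \<open>(i, j)\<close>.\<close>

type_synonym exponent = "nat \<times> nat \<Rightarrow>\<^sub>0 nat"

definition vars :: "nat \<Rightarrow> (nat \<Rightarrow> nat) \<Rightarrow> (nat \<times> nat) set" where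
  "vars s n = {(i, j). j \<in> {1..s} \<and> i \<in> {0..n j}}"

definition monomials :: "nat \<Rightarrow> (nat \<Rightarrow> nat) \<Rightarrow> (nat \<Rightarrow> nat) \<Rightarrow> exponent set" where
  "monomials s n a = {m. Poly_Mapping.keys m \<subseteq> vars s n \<and>
     (\<forall>j\<in>{1..s}. (\<Sum>i=0..n j. Poly_Mapping.lookup m (i, j)) = a j)}"

definition multiforms ::
  "nat \<Rightarrow> (nat \<Rightarrow> nat) \<Rightarrow> (nat \<Rightarrow> nat) \<Rightarrow> (nat \<times> nat, 'k::field) mpoly set" where
  "multiforms s n a = coord_space (monomials s n a)"

definition unit_degree :: "nat \<Rightarrow> nat \<Rightarrow> nat" where
  "unit_degree j = (\<lambda>i. if i = j then 1 else 0)"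

text \<open>Meaningful when the characteristic is \<open>0\<close> or larger than \<open>a\<close>.\<close>

definition divided_power ::
  "('v, 'k::field) mpoly \<Rightarrow> nat \<Rightarrow> ('v, 'k) mpoly" where
  "divided_power l a = scale (inverse (of_nat (fact a))) (l ^ a)"

definition segre_veronese ::
  "nat \<Rightarrow> (nat \<Rightarrow> nat) \<Rightarrow> (nat \<Rightarrow> nat) \<Rightarrow> (exponent, 'k::field) proj_point set" where
  "segre_veronese s n d = {proj_point (\<Prod>j=1..s. divided_power (l j) (d j)) | l.
     \<forall>j\<in>{1..s}. l j \<in> multiforms s n (unit_degree j) \<and> l j \<noteq> 0}"

text \<open>
  The homogeneous coordinates on the projective space of \<open>multiforms s n d\<close> are the coefficients
  of the monomials of multidegree \<open>d\<close>, so its coordinate ring is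
  \<open>poly_ring (monomials s n d)\<close>. The infimum is \<open>\<infinity>\<close> if no such subscheme exists, and it is
  attained otherwise.
\<close>

definition cactus_rank ::
  "nat \<Rightarrow> (nat \<Rightarrow> nat) \<Rightarrow> (nat \<Rightarrow> nat) \<Rightarrow> (exponent, 'k::field) proj_point \<Rightarrow> enat" where
  "cactus_rank s n d f = Inf {enat m | m. \<exists>Z :: (exponent, 'k) mpoly set.
     zero_dim_subscheme (monomials s n d) Z m \<and>
     vanishing_ideal (monomials s n d) (segre_veronese s n d) \<subseteq> Z \<and>
     f \<in> linear_span (monomials s n d) Z}"

end

theory Submission
  imports Defs
begin

text \<open>
  Dehomogenize the form at all \<open>x\<^bsub>0,j\<^esub> = 1\<close>: with divided powers this gives a polynomial \<open>g\<close>
  of degree at most \<open>d\<close> in \<open>n\<close> variables. Differential operators with constant coefficients that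
  annihilate \<open>g\<close> form an ideal, which defines a scheme supported at one point of an affine chart
  of the product of projective spaces. A hyperplane containing the image of this scheme corresponds to
  an operator annihilating \<open>g\<close>, and the constant term of the result is the value of the hyperplane
  equation at the form; so the form lies in the span. The length of the scheme is the dimension of
  the space of all partial derivatives of \<open>g\<close>. It is at most the number of monomials of degree at
  most \<open>k\<close> (derivatives of order at most \<open>k\<close>) plus the number of monomials of degree at most
  \<open>d - k - 1\<close> (which span all derivatives of higher order).
\<close>


section \<open>Linear functionals, monomials and powers of linear forms\<close>

abbreviation coeff_at :: "('v \<Rightarrow>\<^sub>0 'a::zero) \<Rightarrow> 'v \<Rightarrow> 'a" where
  "coeff_at \<equiv> Poly_Mapping.lookup"

lemma sum_single_lookup: "(\<Sum>m\<in>Poly_Mapping.keys p. Poly_Mapping.single m (coeff_at p m)) = p"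
  by (rule poly_mapping_eqI)
    (simp add: lookup_sum lookup_single when_def in_keys_iff)

section \<open>Linear functionals determined by their values on monomials\<close>

text \<open>The values at the basis elements are arbitrary, so evaluations, hyperplanes and
  apolarity conditions all take this form. Only a semiring is required, since
  \<open>pull_exp\<close> is described by such sums over the natural numbers.\<close>

definition extend :: "('m \<Rightarrow> 'a::comm_semiring_0) \<Rightarrow> ('m \<Rightarrow>\<^sub>0 'a) \<Rightarrow> 'a" where
  "extend w G = (\<Sum>M\<in>Poly_Mapping.keys G. coeff_at G M * w M)"

lemma extend_superset:
  assumes "finite S" "Poly_Mapping.keys G \<subseteq> S"
  shows "extend w G = (\<Sum>M\<in>S. coeff_at G M * w M)"
  unfolding extend_def using assms
  by (intro sum.mono_neutral_left) (auto simp: in_keys_iff)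

lemma extend_zero [simp]: "extend w 0 = 0"
  by (simp add: extend_def)

lemma extend_zero_fun [simp]: "extend (\<lambda>_. 0) G = 0"
  by (simp add: extend_def)

lemma extend_add: "extend w (F + G) = extend w F + extend w G"
proof -
  let ?S = "Poly_Mapping.keys F \<union> Poly_Mapping.keys G"
  have "extend w (F + G) = (\<Sum>M\<in>?S. coeff_at (F + G) M * w M)"
    by (rule extend_superset) (simp_all add: Poly_Mapping.keys_add)
  moreover have "extend w F = (\<Sum>M\<in>?S. coeff_at F M * w M)" "extend w G = (\<Sum>M\<in>?S. coeff_at G M * w M)"
    by (rule extend_superset; auto)+
  ultimately show ?thesis
    by (simp add: lookup_add distrib_right sum.distrib)
qed

lemma extend_sum: "extend w (sum g S) = (\<Sum>i\<in>S. extend w (g i))"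
  by (induction S rule: infinite_finite_induct) (auto simp: extend_add)

lemma extend_single [simp]: "extend w (Poly_Mapping.single m c) = c * w m"
  by (simp add: extend_def)

lemma extend_scale: "extend w (scale c G) = c * extend w G"
proof -
  have "extend w (scale c G) = (\<Sum>M\<in>Poly_Mapping.keys G. coeff_at (scale c G) M * w M)"
    by (rule extend_superset) (auto simp: in_keys_iff)
  then show ?thesis
    by (simp add: extend_def sum_distrib_left mult_ac)
qed

lemma extend_cong: "(\<And>M. M \<in> Poly_Mapping.keys G \<Longrightarrow> w M = w' M) \<Longrightarrow> extend w G = extend w' G"
  by (simp add: extend_def)

lemma extend_cmult: "extend (\<lambda>M. c * w M) G = c * extend w G"
  by (simp add: extend_def sum_distrib_left mult_ac)

lemma mult_eq_sum_single:
  "F * G = (\<Sum>l\<in>Poly_Mapping.keys F. \<Sum>q\<in>Poly_Mapping.keys G.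
     Poly_Mapping.single (l + q) (coeff_at F l * coeff_at G q))"
proof -
  have "F * G = (\<Sum>l\<in>Poly_Mapping.keys F. Poly_Mapping.single l (coeff_at F l)) *
      (\<Sum>q\<in>Poly_Mapping.keys G. Poly_Mapping.single q (coeff_at G q))"
    by (simp only: sum_single_lookup)
  then show ?thesis
    by (simp add: sum_product mult_single)
qed

text \<open>A product is the sum of the products of its terms; for each monomial \<open>l\<close> of
  \<open>F\<close> the functional shifted by \<open>l\<close> acts on \<open>G\<close>. The ideal
  property of \<open>apolar_ideal\<close> rests on this.\<close>

lemma extend_mult:
  "extend w (F * G) = extend (\<lambda>l. extend (\<lambda>q. w (l + q)) G) F"
  unfolding mult_eq_sum_single[of F G] extend_sum extend_single
  by (simp add: extend_def sum_distrib_left mult_ac)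

text \<open>A coefficient is the functional that is 1 at one exponent and 0 at all others.\<close>

lemma lookup_mult_eq_extend:
  fixes F G :: "'m::monoid_add \<Rightarrow>\<^sub>0 'a::comm_semiring_1"
  shows
  "coeff_at (F * G) \<alpha> = extend (\<lambda>l. extend (\<lambda>q. if l + q = \<alpha> then 1 else 0) G) F"
proof -
  have "coeff_at H \<alpha> = extend (\<lambda>m. if m = \<alpha> then 1 else 0) H" for H :: "'m \<Rightarrow>\<^sub>0 'a"
    by (auto simp: extend_def if_distrib in_keys_iff cong: if_cong)
  then show ?thesis
    by (simp add: extend_mult)
qed

lemma lookup_single_mult:
  fixes u \<beta> :: "'v \<Rightarrow>\<^sub>0 nat" and p :: "('v, 'a::comm_semiring_1) mpoly"
  shows "coeff_at (Poly_Mapping.single u c * p) (u + \<beta>) = c * coeff_at p \<beta>"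
  unfolding lookup_mult_eq_extend
  by (simp add: extend_def if_distrib in_keys_iff cong: if_cong)

lemma lookup_single_mult_eq_0:
  fixes u \<alpha> :: "'v \<Rightarrow>\<^sub>0 nat" and p :: "('v, 'a::comm_semiring_1) mpoly"
  assumes "\<And>\<beta>. \<alpha> \<noteq> u + \<beta>"
  shows "coeff_at (Poly_Mapping.single u c * p) \<alpha> = 0"
proof -
  have "u + \<beta> \<noteq> \<alpha>" for \<beta> using assms by metis
  then show ?thesis unfolding lookup_mult_eq_extend by (simp add: extend_def)
qed

section \<open>Values of monomials and total degrees\<close>

definition mon :: "('v \<Rightarrow> 'a::comm_semiring_1) \<Rightarrow> ('v \<Rightarrow>\<^sub>0 nat) \<Rightarrow> 'a" where
  "mon y m = (\<Prod>v\<in>Poly_Mapping.keys m. y v ^ coeff_at m v)"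

lemma mon_superset:
  assumes "finite S" "Poly_Mapping.keys m \<subseteq> S"
  shows "mon y m = (\<Prod>v\<in>S. y v ^ coeff_at m v)"
  unfolding mon_def using assms
  by (intro prod.mono_neutral_left) (auto simp: in_keys_iff)

lemma mon_zero [simp]: "mon y 0 = 1"
  by (simp add: mon_def)

lemma mon_single [simp]: "mon y (Poly_Mapping.single v k) = y v ^ k"
  by (cases "k = 0") (auto simp: mon_def)

lemma mon_add: "mon y (m + m') = mon y m * mon y m'"
proof -
  let ?S = "Poly_Mapping.keys m \<union> Poly_Mapping.keys m'"
  have "mon y (m + m') = (\<Prod>v\<in>?S. y v ^ coeff_at (m + m') v)"
    by (rule mon_superset) (simp_all add: Poly_Mapping.keys_add)
  moreover have "mon y m = (\<Prod>v\<in>?S. y v ^ coeff_at m v)" "mon y m' = (\<Prod>v\<in>?S. y v ^ coeff_at m' v)"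
    by (rule mon_superset; auto)+
  ultimately show ?thesis
    by (simp add: lookup_add power_add prod.distrib)
qed

lemma mon_sum: "finite S \<Longrightarrow> mon y (sum g S) = (\<Prod>i\<in>S. mon y (g i))"
  by (induction S rule: finite_induct) (auto simp: mon_add)

lemma mon_cong: "(\<And>v. v \<in> Poly_Mapping.keys m \<Longrightarrow> y v = y' v) \<Longrightarrow> mon y m = mon y' m"
  by (simp add: mon_def)

lemma mon_mult: "mon (\<lambda>v. y v * y' v) m = mon y m * mon y' m"
  by (simp add: mon_def power_mult_distrib prod.distrib)

lemma mon_nonzero:
  fixes y :: "'v \<Rightarrow> 'k::field"
  assumes "\<And>v. v \<in> Poly_Mapping.keys m \<Longrightarrow> y v \<noteq> 0"
  shows "mon y m \<noteq> 0"
  using assms by (simp add: mon_def)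

lemma lookup_map_times [simp]: "coeff_at (Poly_Mapping.map ((*) (c::nat)) p) v = c * coeff_at p v"
  by (simp add: Poly_Mapping.map.rep_eq when_def)

lemma mon_map_times: "mon y (Poly_Mapping.map ((*) c) m) = mon y m ^ c"
proof -
  have "mon y (Poly_Mapping.map ((*) c) m) = (\<Prod>v\<in>Poly_Mapping.keys m. y v ^ (c * coeff_at m v))"
    by (subst mon_superset[where S = "Poly_Mapping.keys m"]) (auto simp: in_keys_iff)
  also have "\<dots> = mon y m ^ c"
    by (simp add: mon_def prod_power_distrib mult.commute flip: power_mult)
  finally show ?thesis .
qed

lemma eval_at_eq_extend: "eval_at F v = extend (mon (coeff_at v)) F"
  by (simp add: eval_at_def extend_def mon_def)

lemma total_deg_superset:
  assumes "finite S" "Poly_Mapping.keys m \<subseteq> S"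
  shows "total_deg m = (\<Sum>v\<in>S. coeff_at m v)"
  unfolding total_deg_def using assms
  by (intro sum.mono_neutral_left) (auto simp: in_keys_iff)

lemma total_deg_add: "total_deg (m + m') = total_deg m + total_deg m'"
proof -
  let ?S = "Poly_Mapping.keys m \<union> Poly_Mapping.keys m'"
  have "total_deg (m + m') = (\<Sum>v\<in>?S. coeff_at (m + m') v)"
    by (rule total_deg_superset) (simp_all add: Poly_Mapping.keys_add)
  moreover have "total_deg m = (\<Sum>v\<in>?S. coeff_at m v)" "total_deg m' = (\<Sum>v\<in>?S. coeff_at m' v)"
    by (rule total_deg_superset; auto)+
  ultimately show ?thesis
    by (simp add: lookup_add sum.distrib)
qed

lemma total_deg_zero [simp]: "total_deg 0 = 0"
  by (simp add: total_deg_def)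

lemma total_deg_single [simp]: "total_deg (Poly_Mapping.single v k) = k"
  by (cases "k = 0") (auto simp: total_deg_def)

lemma total_deg_eq_0_iff: "total_deg m = 0 \<longleftrightarrow> m = 0"
  by (auto simp: total_deg_def poly_mapping_eq_iff fun_eq_iff in_keys_iff)

lemma exponent_split_single:
  fixes \<alpha> :: "'v \<Rightarrow>\<^sub>0 nat"
  assumes "coeff_at \<alpha> v > 0"
  obtains \<beta> where "\<alpha> = Poly_Mapping.single v 1 + \<beta>"
proof
  show "\<alpha> = Poly_Mapping.single v 1 + (\<alpha> - Poly_Mapping.single v 1)"
    using assms by (intro poly_mapping_eqI) (auto simp: lookup_add lookup_minus lookup_single when_def)
qed

lemma keys_add_nat:
  fixes m m' :: "'v \<Rightarrow>\<^sub>0 nat"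
  shows "Poly_Mapping.keys (m + m') = Poly_Mapping.keys m \<union> Poly_Mapping.keys m'"
  by (auto simp: in_keys_iff lookup_add)

section \<open>Factorials of exponents and coefficients of powers of linear forms\<close>

text \<open>This is the multi-index factorial; it converts coefficients with respect to ordinary
  monomials into coefficients with respect to divided powers.\<close>

definition exp_fact :: "('v \<Rightarrow>\<^sub>0 nat) \<Rightarrow> nat" where
  "exp_fact m = (\<Prod>v\<in>Poly_Mapping.keys m. fact (coeff_at m v))"

lemma exp_fact_superset:
  assumes "finite S" "Poly_Mapping.keys m \<subseteq> S"
  shows "exp_fact m = (\<Prod>v\<in>S. fact (coeff_at m v))"
  unfolding exp_fact_def using assms
  by (intro prod.mono_neutral_left) (auto simp: in_keys_iff)

lemma exp_fact_Suc:
  "exp_fact (Poly_Mapping.single v 1 + \<beta>) = Suc (coeff_at \<beta> v) * exp_fact \<beta>"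
proof -
  let ?S = "insert v (Poly_Mapping.keys \<beta>)"
  have "exp_fact (Poly_Mapping.single v 1 + \<beta>) = (\<Prod>u\<in>?S. fact (coeff_at (Poly_Mapping.single v 1 + \<beta>) u))"
    by (rule exp_fact_superset) (auto simp: keys_add_nat)
  also have "\<dots> = (\<Prod>u\<in>?S. (if u = v then Suc (coeff_at \<beta> v) else 1) * fact (coeff_at \<beta> u))"
    by (intro prod.cong refl) (auto simp: lookup_add lookup_single when_def)
  also have "\<dots> = Suc (coeff_at \<beta> v) * (\<Prod>u\<in>?S. fact (coeff_at \<beta> u))"
    by (simp add: prod.distrib)
  also have "(\<Prod>u\<in>?S. fact (coeff_at \<beta> u)) = exp_fact \<beta>"
    by (rule exp_fact_superset[symmetric]) auto
  finally show ?thesis .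
qed

definition linear_form :: "('v \<Rightarrow> 'a::comm_semiring_1) \<Rightarrow> 'v set \<Rightarrow> ('v, 'a) mpoly" where
  "linear_form y V = (\<Sum>v\<in>V. Poly_Mapping.single (Poly_Mapping.single v 1) (y v))"

text \<open>The factorials are multiplied out, so that no division is needed.\<close>

lemma lookup_linear_form_power:
  assumes "finite V" "Poly_Mapping.keys \<alpha> \<subseteq> V" "total_deg \<alpha> = D"
  shows "of_nat (exp_fact \<alpha>) * coeff_at (linear_form y V ^ D) \<alpha> = of_nat (fact D) * mon y \<alpha>"
  using assms(2,3)
proof (induction D arbitrary: \<alpha>)
  case 0
  then have "\<alpha> = 0" by (simp add: total_deg_eq_0_iff)
  then show ?case by (simp add: exp_fact_def)
next
  case (Suc D)
  \<comment> \<open>One factor of the power is split off. Its term at \<open>v\<close> contributes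
    with multiplicity equal to the exponent of \<open>v\<close>, and these multiplicities add up to
    the total degree \<open>Suc D\<close>.\<close>
  have summand: "of_nat (exp_fact \<alpha>) *
      coeff_at (Poly_Mapping.single (Poly_Mapping.single v 1) (y v) * linear_form y V ^ D) \<alpha> =
      of_nat (coeff_at \<alpha> v) * (of_nat (fact D) * mon y \<alpha>)" if "v \<in> V" for v
  proof (cases "coeff_at \<alpha> v = 0")
    case True
    then have "\<alpha> \<noteq> Poly_Mapping.single v 1 + \<beta>" for \<beta>
      by (auto simp: lookup_add)
    then show ?thesis using True by (simp add: lookup_single_mult_eq_0)
  next
    case False
    then obtain \<beta> where \<beta>: "\<alpha> = Poly_Mapping.single v 1 + \<beta>"
      using exponent_split_single[of \<alpha> v] by auto
    have "Poly_Mapping.keys \<beta> \<subseteq> V" "total_deg \<beta> = D"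
      using Suc.prems by (auto simp: \<beta> keys_add_nat total_deg_add)
    then have IH: "of_nat (exp_fact \<beta>) * coeff_at (linear_form y V ^ D) \<beta> = of_nat (fact D) * mon y \<beta>"
      by (rule Suc.IH)
    have "of_nat (exp_fact \<alpha>) *
      coeff_at (Poly_Mapping.single (Poly_Mapping.single v 1) (y v) * linear_form y V ^ D) \<alpha> =
      of_nat (Suc (coeff_at \<beta> v)) * (y v * (of_nat (exp_fact \<beta>) * coeff_at (linear_form y V ^ D) \<beta>))"
      unfolding \<beta> lookup_single_mult exp_fact_Suc of_nat_mult by (simp only: mult_ac)
    also have "\<dots> = of_nat (coeff_at \<alpha> v) * (of_nat (fact D) * mon y \<alpha>)"
      unfolding IH \<beta> mon_add by (simp add: lookup_add mult_ac)
    finally show ?thesis .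
  qed
  have "of_nat (exp_fact \<alpha>) * coeff_at (linear_form y V ^ Suc D) \<alpha> =
    (\<Sum>v\<in>V. of_nat (exp_fact \<alpha>) *
      coeff_at (Poly_Mapping.single (Poly_Mapping.single v 1) (y v) * linear_form y V ^ D) \<alpha>)"
    by (simp add: linear_form_def[of y V] sum_distrib_right lookup_sum sum_distrib_left)
  also have "\<dots> = (\<Sum>v\<in>V. of_nat (coeff_at \<alpha> v)) * (of_nat (fact D) * mon y \<alpha>)"
    unfolding sum_distrib_right by (intro sum.cong refl summand)
  also have "(\<Sum>v\<in>V. of_nat (coeff_at \<alpha> v)) = of_nat (Suc D)"
    using total_deg_superset[OF assms(1) Suc.prems(1)] Suc.prems(2) by (simp flip: of_nat_sum)
  finally show ?case
    by (simp only: fact_Suc of_nat_mult of_nat_id mult_ac)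
qed

text \<open>On monomials this substitutes 1 for every variable outside \<open>A\<close>. It serves
  both to isolate one block of variables and to dehomogenize.\<close>

definition exp_restrict :: "'v set \<Rightarrow> ('v \<Rightarrow>\<^sub>0 nat) \<Rightarrow> ('v \<Rightarrow>\<^sub>0 nat)" where
  "exp_restrict A m = Poly_Mapping.mapp (\<lambda>v c. c when v \<in> A) m"

lemma lookup_exp_restrict [simp]: "coeff_at (exp_restrict A m) v = (if v \<in> A then coeff_at m v else 0)"
  by (auto simp: exp_restrict_def lookup_mapp when_def in_keys_iff)

lemma keys_exp_restrict [simp]: "Poly_Mapping.keys (exp_restrict A m) = Poly_Mapping.keys m \<inter> A"
  by (auto simp: in_keys_iff split: if_splits)

lemma exp_restrict_add_exp_restrict:
  assumes "Poly_Mapping.keys m \<subseteq> A \<union> B" "A \<inter> B = {}"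
  shows "m = exp_restrict A m + exp_restrict B m"
  using assms by (intro poly_mapping_eqI) (auto simp: lookup_add in_keys_iff)

lemma exp_restrict_exp_restrict: "exp_restrict A (exp_restrict B m) = exp_restrict (A \<inter> B) m"
  by (rule poly_mapping_eqI) simp

text \<open>An exponent on a disjoint union splits in exactly one way, so only one pair of terms
  contributes.\<close>

lemma lookup_mult_disjoint:
  fixes P Q :: "('v, 'a::comm_semiring_1) mpoly"
  assumes "P \<in> poly_ring A" "Q \<in> poly_ring B" "A \<inter> B = {}" "Poly_Mapping.keys \<alpha> \<subseteq> A \<union> B"
  shows "coeff_at (P * Q) \<alpha> = coeff_at P (exp_restrict A \<alpha>) * coeff_at Q (exp_restrict B \<alpha>)"
proof -
  have eq: "l + q = \<alpha> \<longleftrightarrow> q = exp_restrict B \<alpha> \<and> l = exp_restrict A \<alpha>"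
    if "l \<in> Poly_Mapping.keys P" "q \<in> Poly_Mapping.keys Q" for l q
  proof
    assume "l + q = \<alpha>"
    moreover have "Poly_Mapping.keys l \<subseteq> A" "Poly_Mapping.keys q \<subseteq> B"
      using that assms by (auto simp: poly_ring_def)
    then have "coeff_at l v = 0" if "v \<notin> A" for v
      using that by (auto simp: in_keys_iff)
    moreover have "coeff_at q v = 0" if "v \<notin> B" for v
      using that \<open>Poly_Mapping.keys q \<subseteq> B\<close> by (auto simp: in_keys_iff)
    moreover have "v \<notin> B" if "v \<in> A" for v
      using that assms(3) by auto
    moreover have "v \<notin> A" if "v \<in> B" for v
      using that assms(3) by auto
    ultimately show "q = exp_restrict B \<alpha> \<and> l = exp_restrict A \<alpha>"
      by (intro conjI poly_mapping_eqI) (auto simp: lookup_add)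
  next
    assume "q = exp_restrict B \<alpha> \<and> l = exp_restrict A \<alpha>"
    then show "l + q = \<alpha>" using exp_restrict_add_exp_restrict[OF assms(4,3)] by simp
  qed
  have "coeff_at (P * Q) \<alpha> = (\<Sum>l\<in>Poly_Mapping.keys P. coeff_at P l * (\<Sum>q\<in>Poly_Mapping.keys Q.
     coeff_at Q q * (if l + q = \<alpha> then 1 else 0)))"
    by (simp add: lookup_mult_eq_extend extend_def)
  also have "\<dots> = (\<Sum>l\<in>Poly_Mapping.keys P. coeff_at P l * (\<Sum>q\<in>Poly_Mapping.keys Q.
     coeff_at Q q * (if q = exp_restrict B \<alpha> then if l = exp_restrict A \<alpha> then 1 else 0 else 0)))"
    by (intro sum.cong refl arg_cong2[where f = "(*)"]) (auto simp: eq)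
  also have "\<dots> = coeff_at P (exp_restrict A \<alpha>) * coeff_at Q (exp_restrict B \<alpha>)"
    by (cases "coeff_at Q (exp_restrict B \<alpha>) = 0") (simp_all add: if_distrib[of "(*) _"] in_keys_iff cong: if_cong)
  finally show ?thesis .
qed

lemma poly_ring_mult:
  "F \<in> poly_ring W \<Longrightarrow> G \<in> poly_ring W \<Longrightarrow> F * G \<in> poly_ring W"
  for F G :: "('v, 'a::comm_semiring_1) mpoly"
  unfolding poly_ring_def using keys_mult[of F G] by (fastforce simp: keys_add_nat)

lemma poly_ring_one [simp]: "1 \<in> poly_ring W"
  by (simp add: poly_ring_def flip: single_one)

lemma poly_ring_mono: "A \<subseteq> B \<Longrightarrow> poly_ring A \<subseteq> poly_ring B"
  by (auto simp: poly_ring_def)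

lemma poly_ring_prod:
  "(\<And>i. i \<in> S \<Longrightarrow> g i \<in> poly_ring W) \<Longrightarrow> prod g S \<in> poly_ring W"
  for g :: "'i \<Rightarrow> ('v, 'a::comm_semiring_1) mpoly"
  by (induction S rule: infinite_finite_induct) (auto intro: poly_ring_mult)

lemma poly_ring_power:
  "F \<in> poly_ring W \<Longrightarrow> F ^ k \<in> poly_ring W"
  for F :: "('v, 'a::comm_semiring_1) mpoly"
  by (induction k) (auto intro: poly_ring_mult)

lemma poly_ring_scale: "F \<in> poly_ring W \<Longrightarrow> scale c F \<in> poly_ring W"
  by (auto simp: poly_ring_def in_keys_iff)

lemma keys_linear_form: "Poly_Mapping.keys (linear_form y V) \<subseteq> (\<lambda>v. Poly_Mapping.single v 1) ` V"
  by (auto simp: in_keys_iff linear_form_def lookup_sum lookup_single when_def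
      elim!: sum.not_neutral_contains_not_neutral split: if_splits)

lemma linear_form_in_poly_ring: "linear_form y V \<in> poly_ring V"
  using keys_linear_form[of y V] by (auto simp: poly_ring_def)

text \<open>Without the hypothesis on \<open>fact (D j)\<close> the divided powers would be zero.\<close>

lemma lookup_prod_divided_power:
  fixes y :: "'v \<Rightarrow> 'k::field"
  assumes "finite J" "\<And>j. j \<in> J \<Longrightarrow> finite (V j)" "\<And>i j. i \<in> J \<Longrightarrow> j \<in> J \<Longrightarrow> i \<noteq> j \<Longrightarrow> V i \<inter> V j = {}"
    and "\<And>j. j \<in> J \<Longrightarrow> of_nat (fact (D j)) \<noteq> (0 :: 'k)"
    and "Poly_Mapping.keys \<alpha> \<subseteq> (\<Union>j\<in>J. V j)"
    and "\<And>j. j \<in> J \<Longrightarrow> total_deg (exp_restrict (V j) \<alpha>) = D j"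
  shows "of_nat (exp_fact \<alpha>) * coeff_at (\<Prod>j\<in>J. divided_power (linear_form y (V j)) (D j)) \<alpha> = mon y \<alpha>"
  using assms
proof (induction J arbitrary: \<alpha> rule: finite_induct)
  case empty
  then have "\<alpha> = 0" by simp
  then show ?case by (simp add: exp_fact_def)
next
  case (insert i J)
  let ?U = "\<Union>j\<in>J. V j"
  let ?\<beta> = "exp_restrict (V i) \<alpha>" and ?\<gamma> = "exp_restrict ?U \<alpha>"
  let ?P = "divided_power (linear_form y (V i)) (D i)"
  let ?Q = "\<Prod>j\<in>J. divided_power (linear_form y (V j)) (D j)"
  have disj: "V i \<inter> ?U = {}"
    using insert.prems(2) insert.hyps by fastforce
  have P: "?P \<in> poly_ring (V i)"
    unfolding divided_power_def by (intro poly_ring_scale poly_ring_power linear_form_in_poly_ring)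
  have Q: "?Q \<in> poly_ring ?U"
  proof (rule poly_ring_prod)
    fix j assume "j \<in> J"
    then have "linear_form y (V j) \<in> poly_ring ?U"
      using linear_form_in_poly_ring[of y "V j"] poly_ring_mono[of "V j" ?U] by blast
    then show "divided_power (linear_form y (V j)) (D j) \<in> poly_ring ?U"
      unfolding divided_power_def by (intro poly_ring_scale poly_ring_power)
  qed
  have sub: "Poly_Mapping.keys \<alpha> \<subseteq> V i \<union> ?U"
    using insert.prems(4) by auto
  have \<alpha>: "\<alpha> = ?\<beta> + ?\<gamma>"
    using exp_restrict_add_exp_restrict[OF sub disj] .
  have IH: "of_nat (exp_fact ?\<gamma>) * coeff_at ?Q ?\<gamma> = mon y ?\<gamma>"
  proof (rule insert.IH)
    fix j assume j: "j \<in> J"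
    then have "V j \<inter> ?U = V j" by auto
    then show "total_deg (exp_restrict (V j) ?\<gamma>) = D j"
      using insert.prems(5) j by (simp add: exp_restrict_exp_restrict)
  qed (use insert.prems in auto)
  have nz: "of_nat (fact (D i)) \<noteq> (0 :: 'k)"
    using insert.prems by blast
  have "of_nat (exp_fact ?\<beta>) * coeff_at (linear_form y (V i) ^ D i) ?\<beta> = of_nat (fact (D i)) * mon y ?\<beta>"
    by (rule lookup_linear_form_power) (use insert.prems in auto)
  \<comment> \<open>The denominator of the divided power cancels the factorial of
    \<open>D i\<close>; this is where its invertibility is needed.\<close>
  then have block: "of_nat (exp_fact ?\<beta>) * coeff_at ?P ?\<beta> = mon y ?\<beta>"
    using nz by (simp add: divided_power_def field_simps)
  \<comment> \<open>Every variable lies on one side only, so one of the two factorials is that of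
    0.\<close>
  have "exp_fact \<alpha> = (\<Prod>v\<in>Poly_Mapping.keys \<alpha>. fact (coeff_at ?\<beta> v) * fact (coeff_at ?\<gamma> v))"
    unfolding exp_fact_def
    by (intro prod.cong refl) (use disj sub in \<open>auto simp: subset_iff disjoint_iff\<close>)
  also have "\<dots> = exp_fact ?\<beta> * exp_fact ?\<gamma>"
    unfolding prod.distrib by (subst (1 2) exp_fact_superset[where S = "Poly_Mapping.keys \<alpha>"]) auto
  finally have fact_split: "exp_fact \<alpha> = exp_fact ?\<beta> * exp_fact ?\<gamma>" .
  have "(\<Prod>j\<in>insert i J. divided_power (linear_form y (V j)) (D j)) = ?P * ?Q"
    using insert.hyps by simp
  then have "of_nat (exp_fact \<alpha>) * coeff_at (\<Prod>j\<in>insert i J. divided_power (linear_form y (V j)) (D j)) \<alpha>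
      = of_nat (exp_fact ?\<beta>) * of_nat (exp_fact ?\<gamma>) * (coeff_at ?P ?\<beta> * coeff_at ?Q ?\<gamma>)"
    by (simp only: lookup_mult_disjoint[OF P Q disj sub] fact_split of_nat_mult)
  also have "\<dots> = (of_nat (exp_fact ?\<beta>) * coeff_at ?P ?\<beta>) * (of_nat (exp_fact ?\<gamma>) * coeff_at ?Q ?\<gamma>)"
    by (simp only: mult_ac)
  also have "\<dots> = mon y (?\<beta> + ?\<gamma>)"
    unfolding block IH mon_add ..
  finally show ?case
    by (rule trans[OF _ arg_cong[OF \<alpha>[symmetric], of "mon y"]])
qed


section \<open>Linear algebra, counting exponents and Kronecker substitution\<close>

lemma scale_single [simp]: "scale c (Poly_Mapping.single v a) = Poly_Mapping.single v (c * a)"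
  by (rule poly_mapping_eqI) (simp add: lookup_single when_def)

text \<open>A basis of \<open>U\<close> stays independent when \<open>v\<close> is added, so a
  functional may be prescribed as 0 on the basis and 1 at \<open>v\<close>. It will provide a
  hyperplane that contains \<open>U\<close> and misses the form.\<close>

lemma separating_functional:
  fixes U :: "('v \<Rightarrow>\<^sub>0 'k::field) set"
  assumes "lin.subspace U" "v \<notin> U"
  obtains h where "\<And>u. u \<in> U \<Longrightarrow> extend h u = 0" "extend h v = 1"
proof -
  interpret pair: vector_space_pair "scale :: 'k \<Rightarrow> ('v \<Rightarrow>\<^sub>0 'k) \<Rightarrow> ('v \<Rightarrow>\<^sub>0 'k)" "(*) :: 'k \<Rightarrow> 'k \<Rightarrow> 'k"
    by unfold_locales (auto simp: algebra_simps)
  obtain B where B: "B \<subseteq> U" "lin.independent B" "U \<subseteq> lin.span B"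
    by (rule lin.maximal_independent_subset)
  have "lin.span B = U"
    using B assms(1) by (metis lin.span_minimal subset_antisym)
  then have "v \<notin> lin.span B" using assms(2) by simp
  then have "lin.independent (insert v B)"
    using B(2) by (rule lin.independent_insertI)
  then obtain g where lin: "Vector_Spaces.linear scale (*) g"
    and g: "\<And>x. x \<in> insert v B \<Longrightarrow> g x = (if x = v then 1 else 0)"
    using pair.linear_independent_extend[where f = "\<lambda>x. if x = v then 1 else 0"] by blast
  interpret g: Vector_Spaces.linear scale "(*)" g by (rule lin)
  \<comment> \<open>A linear functional is determined by its values on the unit vectors, which
    brings \<open>g\<close> into the form \<open>extend h\<close>.\<close>
  define h where "h = (\<lambda>\<alpha>. g (Poly_Mapping.single \<alpha> 1))"
  have gh: "g u = extend h u" for u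
  proof -
    have "g u = g (\<Sum>\<alpha>\<in>Poly_Mapping.keys u. scale (coeff_at u \<alpha>) (Poly_Mapping.single \<alpha> 1))"
      by (simp add: sum_single_lookup)
    then show ?thesis
      by (simp only: g.sum g.scale extend_def h_def)
  qed
  have "g u = 0" if "u \<in> U" for u
  proof (rule pair.linear_eq_0_on_span[OF lin])
    show "u \<in> lin.span B" using that B by auto
    fix x assume "x \<in> B"
    then show "g x = 0"
      using g[of x] \<open>v \<notin> lin.span B\<close> lin.span_base by auto
  qed
  with g[of v] show thesis
    using that[of h] by (auto simp: gh)
qed

text \<open>Rank-nullity on a finite-dimensional subspace, stated as a difference to match the shape
  of \<open>hilbert_function\<close>. The vectors that complete a basis of the kernel to one of
  \<open>S\<close> map to a basis of the image.\<close>

lemma dim_diff_dim_kernel: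
  fixes T :: "('v \<Rightarrow>\<^sub>0 'k::field) \<Rightarrow> ('w \<Rightarrow>\<^sub>0 'k)"
  assumes linT: "Vector_Spaces.linear scale scale T"
    and S: "lin.subspace S" "S \<subseteq> lin.span B0" "finite B0"
  shows "lin.dim S - lin.dim (S \<inter> {x. T x = 0}) = lin.dim (T ` S)"
proof -
  interpret T: Vector_Spaces.linear scale scale T by (rule linT)
  let ?K = "S \<inter> {x. T x = 0}"
  obtain B1 where B1: "B1 \<subseteq> ?K" "lin.independent B1" "?K \<subseteq> lin.span B1"
    by (rule lin.maximal_independent_subset)
  obtain B where B: "B1 \<subseteq> B" "B \<subseteq> S" "lin.independent B" "S \<subseteq> lin.span B"
    using lin.maximal_independent_subset_extend[of B1 S] B1 by auto
  have finB: "finite B"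
    using lin.independent_span_bound[OF S(3) B(3)] B(2) S(2) by blast
  define C where "C = B - B1"
  have indC: "lin.independent C"
    using B(3) lin.independent_mono[of B C] by (auto simp: C_def)
  \<comment> \<open>A difference in the kernel is spanned by \<open>C\<close> and also by
    \<open>B1\<close>. These are disjoint parts of the basis \<open>B\<close>, so all its
    coordinates are 0.\<close>
  have "inj_on T (lin.span C)"
  proof (rule inj_onI)
    fix x y assume xy: "x \<in> lin.span C" "y \<in> lin.span C" "T x = T y"
    let ?z = "x - y"
    have z: "?z \<in> lin.span C" using xy by (simp add: lin.span_diff)
    have "lin.span C \<subseteq> S"
      using B(2) S(1) by (intro lin.span_minimal) (auto simp: C_def)
    then have "?z \<in> ?K" using z xy by (auto simp: T.diff)
    then have z': "?z \<in> lin.span B1" using B1 by auto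
    have "lin.representation B ?z = lin.representation C ?z"
      by (rule lin.representation_extend[OF B(3) z]) (auto simp: C_def)
    moreover have "lin.representation B ?z = lin.representation B1 ?z"
      by (rule lin.representation_extend[OF B(3) z' B(1)])
    ultimately have "lin.representation C ?z b = 0" for b
      using lin.representation_ne_zero[of C ?z b] lin.representation_ne_zero[of B1 ?z b]
      by (auto simp: C_def)
    then have "?z = 0"
      using lin.sum_nonzero_representation_eq[OF indC z] by simp
    then show "x = y" by simp
  qed
  then have injC: "inj_on T C" and indTC: "lin.independent (T ` C)"
    using T.independent_injective_image[OF indC] inj_on_subset lin.span_superset by blast+
  have "T ` S \<subseteq> T ` lin.span B" using B(4) by auto
  also have "\<dots> = lin.span (T ` B)" by (simp add: T.span_image)
  also have "\<dots> \<subseteq> lin.span (insert 0 (T ` C))"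
    using B1(1) by (intro lin.span_mono) (auto simp: C_def)
  finally have "T ` S \<subseteq> lin.span (T ` C)" by simp
  moreover have "T ` C \<subseteq> T ` S" using B(2) by (auto simp: C_def)
  ultimately have "lin.dim (T ` S) = card (T ` C)"
    using indTC by (simp add: lin.basis_card_eq_dim)
  also have "\<dots> = card C" using injC by (rule card_image)
  also have "\<dots> = card B - card B1"
    unfolding C_def using B(1) finB by (simp add: card_Diff_subset finite_subset)
  also have "card B = lin.dim S" using B by (simp add: lin.basis_card_eq_dim)
  also have "card B1 = lin.dim ?K" using B1 by (intro lin.basis_card_eq_dim)
  finally show ?thesis ..
qed

text \<open>Pascal's recursion: either \<open>v\<close> does not occur, or one copy of it can be
  removed. Finiteness is carried along because the cardinality of an infinite set is 0 by
  convention.\<close>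

lemma finite_card_exponents:
  assumes "finite V"
  shows "finite {m. Poly_Mapping.keys m \<subseteq> V \<and> total_deg m \<le> k} \<and>
    card {m. Poly_Mapping.keys m \<subseteq> V \<and> total_deg m \<le> k} \<le> (card V + k) choose k"
  using assms
proof (induction V arbitrary: k rule: finite_induct)
  case empty
  have "{m. Poly_Mapping.keys m \<subseteq> ({} :: 'a set) \<and> total_deg m \<le> k} = {0}" by auto
  then show ?case by simp
next
  case (insert v V)
  let ?E = "\<lambda>V k. {m. Poly_Mapping.keys m \<subseteq> V \<and> total_deg m \<le> k}"
  show ?case
  proof (induction k)
    case 0
    have "?E (insert v V) 0 = {0}" by (auto simp: total_deg_eq_0_iff)
    then show ?case by simp
  next
    case (Suc k)
    have sub: "?E (insert v V) (Suc k) \<subseteq> ?E V (Suc k) \<union> (+) (Poly_Mapping.single v 1) ` ?E (insert v V) k"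
    proof
      fix m assume m: "m \<in> ?E (insert v V) (Suc k)"
      show "m \<in> ?E V (Suc k) \<union> (+) (Poly_Mapping.single v 1) ` ?E (insert v V) k"
      proof (cases "coeff_at m v = 0")
        case True
        then show ?thesis using m by (auto simp: in_keys_iff)
      next
        case False
        then obtain \<beta> where "m = Poly_Mapping.single v 1 + \<beta>"
          using exponent_split_single[of m v] by auto
        then show ?thesis using m by (auto simp: keys_add_nat total_deg_add)
      qed
    qed
    have fin: "finite (?E V (Suc k) \<union> (+) (Poly_Mapping.single v 1) ` ?E (insert v V) k)"
      using insert.IH Suc by blast
    have "card (?E (insert v V) (Suc k)) \<le> card (?E V (Suc k)) + card ((+) (Poly_Mapping.single v 1) ` ?E (insert v V) k)"
      by (rule order_trans[OF card_mono[OF fin sub] card_Un_le])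
    also have "\<dots> \<le> ((card V + Suc k) choose Suc k) + ((card (insert v V) + k) choose k)"
      using insert.IH Suc card_image_le by (meson add_mono order_trans)
    also have "\<dots> = (card (insert v V) + Suc k) choose Suc k"
      using insert.hyps by simp
    finally show ?case using finite_subset[OF sub fin] by blast
  qed
qed

text \<open>In the induction step the new weight exceeds all values of the linear form found so far.\<close>

lemma kronecker_inj:
  assumes "finite V" "finite A" "\<And>m. m \<in> A \<Longrightarrow> Poly_Mapping.keys m \<subseteq> V"
  shows "\<exists>\<kappa> :: 'v \<Rightarrow> nat. inj_on (\<lambda>m. \<Sum>v\<in>V. \<kappa> v * coeff_at m v) A"
  using assms
proof (induction V arbitrary: A rule: finite_induct)
  case empty
  then have "A \<subseteq> {0}" by auto
  then have "inj_on (\<lambda>m. \<Sum>v\<in>{}. 0 * coeff_at m v) A" by (auto simp: inj_on_def)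
  then show ?case by auto
next
  case (insert u U)
  let ?r = "exp_restrict U"
  obtain \<kappa> where \<kappa>: "inj_on (\<lambda>m. \<Sum>v\<in>U. \<kappa> v * coeff_at m v) (?r ` A)"
  proof -
    have "Poly_Mapping.keys m \<subseteq> U" if "m \<in> ?r ` A" for m using that by auto
    then show thesis using insert.IH[of "?r ` A"] insert.prems(1) that by blast
  qed
  define s where "s m = (\<Sum>v\<in>U. \<kappa> v * coeff_at m v)" for m
  have sr: "s (?r m) = s m" for m by (simp add: s_def)
  \<comment> \<open>Inserting 0 keeps the maximum meaningful when \<open>A\<close> is empty.\<close>
  define N where "N = Suc (Max (insert 0 (s ` A)))"
  have sN: "s m < N" if "m \<in> A" for m
    using that insert.prems by (simp add: N_def le_imp_less_Suc)
  have "inj_on (\<lambda>m. \<Sum>v\<in>insert u U. (\<kappa>(u := N)) v * coeff_at m v) A"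
  proof (rule inj_onI)
    fix m m' assume m: "m \<in> A" "m' \<in> A"
    have eq: "(\<Sum>v\<in>insert u U. (\<kappa>(u := N)) v * coeff_at m v) = N * coeff_at m u + s m" for m
    proof -
      have "(\<Sum>v\<in>U. (\<kappa>(u := N)) v * coeff_at m v) = s m"
        unfolding s_def using insert.hyps by (intro sum.cong) auto
      then show ?thesis using insert.hyps by simp
    qed
    assume "(\<Sum>v\<in>insert u U. (\<kappa>(u := N)) v * coeff_at m v) = (\<Sum>v\<in>insert u U. (\<kappa>(u := N)) v * coeff_at m' v)"
    then have eqN: "N * coeff_at m u + s m = N * coeff_at m' u + s m'" unfolding eq .
    \<comment> \<open>The remaining sum is below \<open>N\<close>, so division by \<open>N\<close>
      recovers the exponent of \<open>u\<close>.\<close>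
    have "coeff_at m u = (N * coeff_at m u + s m) div N" using sN[OF m(1)] by simp
    also have "\<dots> = coeff_at m' u" unfolding eqN using sN[OF m(2)] by simp
    finally have u: "coeff_at m u = coeff_at m' u" .
    then have "s m = s m'" using eqN by simp
    then have "s (?r m) = s (?r m')" by (simp only: sr)
    then have "?r m = ?r m'"
      by (rule inj_onD[OF \<kappa>[folded s_def]]) (use m in auto)
    then have U: "coeff_at m v = coeff_at m' v" if "v \<in> U" for v
      using that by (metis lookup_exp_restrict)
    show "m = m'"
    proof (rule poly_mapping_eqI)
      fix v
      show "coeff_at m v = coeff_at m' v"
      proof (cases "v \<in> insert u U")
        case True
        then show ?thesis using u U by auto
      next
        case False
        then have "v \<notin> Poly_Mapping.keys m" "v \<notin> Poly_Mapping.keys m'"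
          using insert.prems(2) m by blast+
        then show ?thesis by (simp add: in_keys_iff)
      qed
    qed
  qed
  then show ?case by blast
qed

text \<open>Over a finite field, the product of all \<open>x - a\<close> plus 1 would be a
  nonconstant polynomial without a root.\<close>

lemma infinite_UNIV_alg_closed: "infinite (UNIV :: 'k::alg_closed_field set)"
proof
  assume fin: "finite (UNIV :: 'k set)"
  define p :: "'k poly" where "p = (\<Prod>a\<in>UNIV. [:-a, 1:]) + 1"
  have "degree (\<Prod>a\<in>(UNIV::'k set). [:-a, 1:]) = card (UNIV :: 'k set)"
    by (subst degree_prod_eq_sum_degree) auto
  moreover have "card (UNIV :: 'k set) > 0" using fin by (simp add: card_gt_0_iff)
  ultimately have "degree p > 0"
    unfolding p_def by (subst degree_add_eq_left) auto
  then obtain x where "poly p x = 0" using alg_closed_imp_poly_has_root by blast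
  moreover have "poly p x = 1" unfolding p_def using fin by (auto simp: poly_prod)
  ultimately show False by simp
qed

text \<open>Kronecker substitution reduces this to polynomials in one variable.\<close>

lemma monomial_functions_independent:
  fixes a :: "'i \<Rightarrow> 'k::field" and e :: "'i \<Rightarrow> ('v \<Rightarrow>\<^sub>0 nat)"
  assumes inf: "infinite (UNIV :: 'k set)" and fin: "finite S" "finite V"
    and keys: "\<And>i. i \<in> S \<Longrightarrow> Poly_Mapping.keys (e i) \<subseteq> V"
    and vanish: "\<And>y. (\<Sum>i\<in>S. a i * mon y (e i)) = 0"
  shows "(\<Sum>i\<in>S. a i * c (e i)) = 0"
proof -
  obtain \<kappa> where inj: "inj_on (\<lambda>m. \<Sum>v\<in>V. \<kappa> v * coeff_at m v) (e ` S)"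
    using kronecker_inj[of V "e ` S"] fin keys by auto
  define s where "s m = (\<Sum>v\<in>V. \<kappa> v * coeff_at m v)" for m
  \<comment> \<open>This is the polynomial in \<open>z\<close> that results from substituting
    \<open>z ^ \<kappa> v\<close> for each variable \<open>v\<close>.\<close>
  define p where "p = (\<Sum>i\<in>S. monom (a i) (s (e i)))"
  have "poly p z = 0" for z
  proof -
    have "mon (\<lambda>v. z ^ \<kappa> v) (e i) = z ^ s (e i)" if "i \<in> S" for i
      using mon_superset[OF fin(2) keys[OF that]]
      by (simp add: s_def power_sum power_mult)
    then show ?thesis
      using vanish[of "\<lambda>v. z ^ \<kappa> v"] by (simp add: p_def poly_sum poly_monom)
  qed
  then have "p = 0"
    using poly_roots_finite[of p] inf by auto
  \<comment> \<open>The map \<open>e\<close> need not be injective: a coefficient of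
    \<open>p\<close> is a sum of \<open>a\<close> over a fiber of \<open>e\<close>, and
    \<open>c\<close> is constant on that fiber.\<close>
  have fiber: "(\<Sum>i\<in>{i \<in> S. e i = \<beta>}. a i * c (e i)) = 0" if "\<beta> \<in> e ` S" for \<beta>
  proof -
    have "coeff p (s \<beta>) = (\<Sum>i\<in>S. if s (e i) = s \<beta> then a i else 0)"
      by (simp add: p_def coeff_sum)
    also have "\<dots> = (\<Sum>i\<in>{i \<in> S. s (e i) = s \<beta>}. a i)"
      using fin by (simp add: sum.inter_filter)
    also have "{i \<in> S. s (e i) = s \<beta>} = {i \<in> S. e i = \<beta>}"
      using inj that by (auto simp: inj_on_def s_def)
    finally have "(\<Sum>i\<in>{i \<in> S. e i = \<beta>}. a i) = 0"
      using \<open>p = 0\<close> by simp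
    moreover have "(\<Sum>i\<in>{i \<in> S. e i = \<beta>}. a i * c (e i)) = (\<Sum>i\<in>{i \<in> S. e i = \<beta>}. a i) * c \<beta>"
      unfolding sum_distrib_right by (intro sum.cong) auto
    ultimately show ?thesis by simp
  qed
  have "(\<Sum>i\<in>S. a i * c (e i)) = (\<Sum>\<beta>\<in>e ` S. \<Sum>i\<in>{i \<in> S. e i = \<beta>}. a i * c (e i))"
    using fin by (intro sum.image_gen)
  also have "\<dots> = 0" using fiber by simp
  finally show ?thesis .
qed

text \<open>A nonzero characteristic is prime, and a prime that divides the factorial of
  \<open>a\<close> is at most \<open>a\<close>.\<close>

lemma of_nat_fact_nonzero:
  assumes "CHAR('k::idom) = 0 \<or> CHAR('k) > a"
  shows "of_nat (fact a) \<noteq> (0 :: 'k)"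
proof
  assume "of_nat (fact a) = (0 :: 'k)"
  then have dvd: "CHAR('k) dvd fact a" by (simp add: of_nat_eq_0_iff_char_dvd)
  then have "CHAR('k) \<noteq> 0" by (metis dvd_0_left fact_nonzero)
  then have "prime (CHAR('k))" by (intro prime_CHAR_semidom) simp
  with dvd have "CHAR('k) \<le> a" by (simp add: prime_dvd_fact_iff)
  with assms \<open>CHAR('k) \<noteq> 0\<close> show False by simp
qed


section \<open>Blocks of variables\<close>

lemma lookup_hom_component:
  "coeff_at (hom_component t F) M = (if total_deg M = t then coeff_at F M else 0)"
  by (auto simp: hom_component_def lookup_sum lookup_single when_def in_keys_iff)

lemma extend_hom_component:
  "extend w (hom_component t F) = extend (\<lambda>M. if total_deg M = t then w M else 0) F"
proof -
  have "extend w (hom_component t F) = (\<Sum>M\<in>Poly_Mapping.keys F. coeff_at (hom_component t F) M * w M)"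
    by (rule extend_superset) (auto simp: in_keys_iff lookup_hom_component split: if_splits)
  then show ?thesis
    by (auto simp: extend_def lookup_hom_component intro!: sum.cong)
qed

lemma hom_component_in_poly_ring: "F \<in> poly_ring W \<Longrightarrow> hom_component t F \<in> poly_ring W"
  by (auto simp: poly_ring_def in_keys_iff lookup_hom_component split: if_splits)

lemma extend_linear_form: "extend w (linear_form y V) = (\<Sum>v\<in>V. y v * w (Poly_Mapping.single v 1))"
  by (simp add: linear_form_def extend_sum)

lemma single_one_eq_iff: "Poly_Mapping.single x (1::nat) = Poly_Mapping.single v 1 \<longleftrightarrow> x = v"
  by (auto dest: arg_cong[where f = Poly_Mapping.keys])

lemma lookup_linear_form:
  "finite V \<Longrightarrow> v \<in> V \<Longrightarrow> coeff_at (linear_form y V) (Poly_Mapping.single v 1) = y v"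
  by (simp add: linear_form_def lookup_sum lookup_single when_def single_one_eq_iff del: One_nat_def)

lemma forms_eq_coord_space:
  "forms W t = coord_space {M. Poly_Mapping.keys M \<subseteq> W \<and> total_deg M = t}"
  by (auto simp: forms_def poly_ring_def coord_space_def)

lemma subspace_coord_space: "lin.subspace (coord_space B :: ('v \<Rightarrow>\<^sub>0 'k::field) set)"
proof (rule lin.subspaceI)
  fix x y :: "'v \<Rightarrow>\<^sub>0 'k" and c
  assume x: "x \<in> coord_space B"
  then show "scale c x \<in> coord_space B"
    by (auto simp: coord_space_def in_keys_iff)
  assume "y \<in> coord_space B"
  with x show "x + y \<in> coord_space B"
    using Poly_Mapping.keys_add[of x y] by (auto simp: coord_space_def)
qed (simp add: coord_space_def)

lemma coord_space_subset_span:
  "coord_space B \<subseteq> lin.span ((\<lambda>b. Poly_Mapping.single b (1 :: 'k::field)) ` B)"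
proof
  fix p :: "'a \<Rightarrow>\<^sub>0 'k" assume p: "p \<in> coord_space B"
  have "(\<Sum>b\<in>Poly_Mapping.keys p. scale (coeff_at p b) (Poly_Mapping.single b 1))
      \<in> lin.span ((\<lambda>b. Poly_Mapping.single b 1) ` B)"
    using p by (intro lin.span_sum lin.span_scale lin.span_base) (auto simp: coord_space_def)
  then show "p \<in> lin.span ((\<lambda>b. Poly_Mapping.single b 1) ` B)"
    by (simp add: sum_single_lookup)
qed

section \<open>Blocks, affine coordinates and monomials of given multidegree\<close>

definition block :: "(nat \<Rightarrow> nat) \<Rightarrow> nat \<Rightarrow> (nat \<times> nat) set" where
  "block ns j = (\<lambda>i. (i, j)) ` {0..ns j}"

definition affine_vars :: "nat \<Rightarrow> (nat \<Rightarrow> nat) \<Rightarrow> (nat \<times> nat) set" where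
  "affine_vars s ns = (\<Union>j\<in>{1..s}. (\<lambda>i. (i, j)) ` {1..ns j})"

lemma vars_eq_UN_block: "vars s ns = (\<Union>j\<in>{1..s}. block ns j)"
  by (auto simp: vars_def block_def)

lemma finite_block [simp]: "finite (block ns j)"
  by (simp add: block_def)

lemma finite_vars [simp]: "finite (vars s ns)"
  by (simp add: vars_eq_UN_block)

lemma finite_affine_vars [simp]: "finite (affine_vars s ns)"
  by (simp add: affine_vars_def)

lemma mem_affine_vars: "(i, j) \<in> affine_vars s ns \<longleftrightarrow> j \<in> {1..s} \<and> i \<in> {1..ns j}"
  by (force simp: affine_vars_def)

lemma affine_vars_subset: "affine_vars s ns \<subseteq> vars s ns"
  by (auto simp: affine_vars_def vars_def)

lemma card_affine_vars: "card (affine_vars s ns) = (\<Sum>j=1..s. ns j)"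
  unfolding affine_vars_def
  by (subst card_UN_disjoint) (auto simp: card_image inj_on_def)

lemma sum_block: "(\<Sum>v\<in>block ns j. g v) = (\<Sum>i=0..ns j. g (i, j))"
  by (simp add: block_def sum.reindex inj_on_def)

lemma sum_vars: "(\<Sum>v\<in>vars s ns. g v) = (\<Sum>j=1..s. \<Sum>i=0..ns j. g (i, j))"
  unfolding vars_eq_UN_block
  by (subst sum.UNION_disjoint) (auto simp: sum_block, auto simp: block_def)

lemma total_deg_monomials: "\<alpha> \<in> monomials s ns ds \<Longrightarrow> total_deg \<alpha> = (\<Sum>j=1..s. ds j)"
  by (subst total_deg_superset[where S = "vars s ns"]) (auto simp: sum_vars monomials_def)

lemma total_deg_exp_restrict_block:
  assumes "\<alpha> \<in> monomials s ns ds" "j \<in> {1..s}"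
  shows "total_deg (exp_restrict (block ns j) \<alpha>) = ds j"
proof -
  have "total_deg (exp_restrict (block ns j) \<alpha>) = (\<Sum>v\<in>block ns j. coeff_at \<alpha> v)"
    by (subst total_deg_superset[where S = "block ns j"]) auto
  then show ?thesis
    using assms by (simp add: sum_block monomials_def)
qed

lemma finite_monomials [simp]: "finite (monomials s ns ds)"
proof (rule finite_subset)
  show "monomials s ns ds \<subseteq> {m. Poly_Mapping.keys m \<subseteq> vars s ns \<and> total_deg m \<le> (\<Sum>j=1..s. ds j)}"
    using total_deg_monomials by (auto simp: monomials_def)
qed (use finite_card_exponents finite_vars in blast)

lemma linear_form_in_multiforms:
  assumes "j \<in> {1..s}"
  shows "linear_form y (block ns j) \<in> multiforms s ns (unit_degree j)"
proof -
  have "Poly_Mapping.single v 1 \<in> monomials s ns (unit_degree j)" if v: "v \<in> block ns j" for v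
  proof -
    obtain i where i: "v = (i, j)" "i \<le> ns j" using v by (auto simp: block_def)
    have "(\<Sum>i'=0..ns j'. coeff_at (Poly_Mapping.single (i, j) 1) (i', j')) = unit_degree j j'" for j'
      using i(2) by (simp add: lookup_single when_def unit_degree_def)
    then show ?thesis
      using i assms by (auto simp: monomials_def vars_def)
  qed
  then show ?thesis
    using keys_linear_form[of y "block ns j"] by (auto simp: multiforms_def coord_space_def)
qed


section \<open>The apolar ideal in an affine chart\<close>

locale multiform =
  fixes s :: nat and ns ds :: "nat \<Rightarrow> nat" and F :: "(nat \<times> nat, 'k::field) mpoly"
  assumes F: "F \<in> multiforms s ns ds"
    and char: "CHAR('k) = 0 \<or> CHAR('k) > (\<Sum>j=1..s. ds j)"
begin

abbreviation "W \<equiv> monomials s ns ds"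
abbreviation "A \<equiv> affine_vars s ns"
abbreviation "res \<equiv> exp_restrict A"

text \<open>The exponent of the monomial that becomes 1 in the chart; its coordinate serves to raise
  degrees without changing pullbacks.\<close>

definition base_exp :: exponent where
  "base_exp = (\<Sum>j=1..s. Poly_Mapping.single (0, j) (ds j))"

lemma lookup_base_exp: "coeff_at base_exp (i, j) = (if i = 0 \<and> j \<in> {1..s} then ds j else 0)"
  by (auto simp: base_exp_def lookup_sum lookup_single when_def)

lemma base_exp_in: "base_exp \<in> W"
  by (auto simp: monomials_def vars_def in_keys_iff lookup_base_exp sum.delta split: if_splits)

lemma res_base_exp [simp]: "res base_exp = 0"
  by (rule poly_mapping_eqI) (auto simp: lookup_base_exp mem_affine_vars)

lemma lookup_zero_var:
  assumes "\<alpha> \<in> W" "j \<in> {1..s}"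
  shows "coeff_at \<alpha> (0, j) + (\<Sum>i=1..ns j. coeff_at (res \<alpha>) (i, j)) = ds j"
proof -
  have "(\<Sum>i=1..ns j. coeff_at (res \<alpha>) (i, j)) = (\<Sum>i=1..ns j. coeff_at \<alpha> (i, j))"
    using assms(2) by (intro sum.cong) (auto simp: mem_affine_vars)
  moreover have "(\<Sum>i=0..ns j. coeff_at \<alpha> (i, j)) = ds j"
    using assms by (simp add: monomials_def)
  ultimately show ?thesis
    by (simp add: sum.atLeast_Suc_atMost)
qed

text \<open>Dehomogenizing loses nothing, because the multidegree determines the exponents of the
  variables set to 1.\<close>

lemma inj_on_res: "inj_on res W"
proof (rule inj_onI)
  fix \<alpha> \<beta> assume \<alpha>: "\<alpha> \<in> W" and \<beta>: "\<beta> \<in> W" and eq: "res \<alpha> = res \<beta>"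
  show "\<alpha> = \<beta>"
  proof (rule poly_mapping_eqI)
    fix v :: "nat \<times> nat"
    obtain i j where v: "v = (i, j)" by (cases v)
    consider "v \<notin> vars s ns" | "v \<in> A" | "i = 0" "j \<in> {1..s}"
      unfolding v by (cases i) (auto simp: mem_affine_vars vars_def)
    then show "coeff_at \<alpha> v = coeff_at \<beta> v"
    proof cases
      case 1
      then have "v \<notin> Poly_Mapping.keys \<alpha>" "v \<notin> Poly_Mapping.keys \<beta>"
        using \<alpha> \<beta> by (auto simp: monomials_def)
      then show ?thesis by (simp add: in_keys_iff)
    next
      case 2
      then show ?thesis using eq by (metis lookup_exp_restrict)
    next
      case 3
      then show ?thesis
        using lookup_zero_var[OF \<alpha> 3(2)] lookup_zero_var[OF \<beta> 3(2)] v eq by simp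
    qed
  qed
qed

text \<open>The degree that is lost by dropping \<open>\<gamma>\<close> is given back to the variables \<open>x\<^bsub>0,j\<^esub>\<close>.\<close>

lemma res_image_down_closed:
  assumes "\<beta> + \<gamma> \<in> res ` W"
  shows "\<beta> \<in> res ` W"
proof -
  obtain \<alpha> where \<alpha>: "\<alpha> \<in> W" "\<beta> + \<gamma> = res \<alpha>" using assms by auto
  have keys: "Poly_Mapping.keys \<beta> \<subseteq> A" "Poly_Mapping.keys \<gamma> \<subseteq> A"
    using arg_cong[OF \<alpha>(2), of Poly_Mapping.keys] by (auto simp: keys_add_nat)
  define u where "u j = coeff_at \<alpha> (0, j) + (\<Sum>i=1..ns j. coeff_at \<gamma> (i, j))" for j
  define \<delta> :: exponent where "\<delta> = (\<Sum>j=1..s. Poly_Mapping.single (0, j) (u j))"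
  have \<delta>: "coeff_at \<delta> (i, j) = (if i = 0 \<and> j \<in> {1..s} then u j else 0)" for i j
    by (auto simp: \<delta>_def lookup_sum lookup_single when_def)
  have \<beta>0: "coeff_at \<beta> (0, j) = 0" for j
    using keys by (auto simp: mem_affine_vars in_keys_iff subset_iff)
  have "\<beta> + \<delta> \<in> W"
    unfolding monomials_def
  proof (intro CollectI conjI ballI)
    show "Poly_Mapping.keys (\<beta> + \<delta>) \<subseteq> vars s ns"
      using keys affine_vars_subset[of s ns]
      by (auto simp: keys_add_nat in_keys_iff \<delta> vars_def split: if_splits)
    fix j assume j: "j \<in> {1..s}"
    have "(\<Sum>i=0..ns j. coeff_at (\<beta> + \<delta>) (i, j)) =
        u j + (\<Sum>i=1..ns j. coeff_at \<beta> (i, j))"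
      using j by (simp add: sum.atLeast_Suc_atMost lookup_add \<delta> \<beta>0)
    also have "\<dots> = coeff_at \<alpha> (0, j) + (\<Sum>i=1..ns j. coeff_at (\<beta> + \<gamma>) (i, j))"
      by (simp add: u_def lookup_add sum.distrib)
    also have "\<dots> = ds j"
      unfolding \<alpha>(2) by (rule lookup_zero_var[OF \<alpha>(1) j])
    finally show "(\<Sum>i=0..ns j. coeff_at (\<beta> + \<delta>) (i, j)) = ds j" .
  qed
  moreover have "res (\<beta> + \<delta>) = \<beta>"
  proof (rule poly_mapping_eqI)
    fix v :: "nat \<times> nat"
    obtain i j where v: "v = (i, j)" by (cases v)
    have "coeff_at \<beta> v = 0" if "v \<notin> A" using that keys by (auto simp: in_keys_iff)
    then show "coeff_at (res (\<beta> + \<delta>)) v = coeff_at \<beta> v"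
      by (auto simp: v \<delta> lookup_add mem_affine_vars)
  qed
  ultimately show ?thesis by (metis imageI)
qed

lemma mon_res:
  assumes "\<alpha> \<in> W" "\<And>j. y (0, j) = 1"
  shows "mon y (res \<alpha>) = mon y \<alpha>"
proof -
  have keys: "Poly_Mapping.keys \<alpha> \<subseteq> vars s ns" using assms by (simp add: monomials_def)
  have "mon y (res \<alpha>) = (\<Prod>v\<in>vars s ns. y v ^ coeff_at (res \<alpha>) v)"
    using keys by (intro mon_superset) auto
  also have "\<dots> = (\<Prod>v\<in>vars s ns. y v ^ coeff_at \<alpha> v)"
  proof (rule prod.cong)
    fix v assume "v \<in> vars s ns"
    then show "y v ^ coeff_at (res \<alpha>) v = y v ^ coeff_at \<alpha> v"
      using assms(2) by (cases v; cases "fst v = 0") (auto simp: vars_def mem_affine_vars)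
  qed simp
  also have "\<dots> = mon y \<alpha>"
    by (rule mon_superset[symmetric]) (use keys in auto)
  finally show ?thesis .
qed

text \<open>Each entry is at most the total degree, which \<open>char\<close> bounds below the
  characteristic if that is not 0.\<close>

lemma of_nat_exp_fact_nonzero:
  assumes "\<alpha> \<in> W"
  shows "of_nat (exp_fact \<alpha>) \<noteq> (0 :: 'k)"
proof -
  have "of_nat (fact (coeff_at \<alpha> v)) \<noteq> (0 :: 'k)" for v
  proof (rule of_nat_fact_nonzero)
    have "coeff_at \<alpha> v \<le> total_deg \<alpha>"
      unfolding total_deg_def by (cases "v \<in> Poly_Mapping.keys \<alpha>") (auto intro: member_le_sum simp: in_keys_iff)
    then show "CHAR('k) = 0 \<or> CHAR('k) > coeff_at \<alpha> v"
      using char total_deg_monomials[OF assms] by auto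
  qed
  then show ?thesis
    by (simp add: exp_fact_def del: of_nat_fact)
qed

text \<open>The coefficients of \<open>F\<close> with respect to divided powers, in the chart in which all
  \<open>x\<^bsub>0,j\<^esub>\<close> equal \<open>1\<close>.\<close>

definition dual :: "exponent \<Rightarrow>\<^sub>0 'k" where
  "dual = (\<Sum>\<alpha>\<in>W. Poly_Mapping.single (res \<alpha>) (of_nat (exp_fact \<alpha>) * coeff_at F \<alpha>))"

lemma lookup_dual:
  assumes "\<alpha> \<in> W"
  shows "coeff_at dual (res \<alpha>) = of_nat (exp_fact \<alpha>) * coeff_at F \<alpha>"
proof -
  have "coeff_at dual (res \<alpha>) =
      (\<Sum>\<beta>\<in>W. if \<beta> = \<alpha> then of_nat (exp_fact \<beta>) * coeff_at F \<beta> else 0)"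
    unfolding dual_def lookup_sum lookup_single when_def
    using inj_on_res assms by (intro sum.cong) (auto simp: inj_on_def)
  then show ?thesis using assms by simp
qed

lemma lookup_dual_eq_0: "\<beta> \<notin> res ` W \<Longrightarrow> coeff_at dual \<beta> = 0"
  unfolding dual_def lookup_sum lookup_single when_def by (intro sum.neutral) auto

text \<open>On divided powers, differentiation is a shift of coefficients.\<close>

definition deriv_dual :: "exponent \<Rightarrow> (exponent \<Rightarrow>\<^sub>0 'k)" where
  "deriv_dual \<beta> = Poly_Mapping.map_key ((+) \<beta>) dual"

lemma lookup_deriv_dual [simp]: "coeff_at (deriv_dual \<beta>) \<gamma> = coeff_at dual (\<beta> + \<gamma>)"
  by (simp add: deriv_dual_def Poly_Mapping.map_key.rep_eq inj_def)

text \<open>In the chart, the coordinate with index \<open>\<alpha>\<close> of a point of the Segre-Veronese variety is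
  \<open>weight\<close> times the monomial with exponent \<open>res \<alpha>\<close>. The next two functions describe the
  pullback of a monomial in the coordinates.\<close>

definition pull_exp :: "(exponent \<Rightarrow>\<^sub>0 nat) \<Rightarrow> exponent" where
  "pull_exp M = (\<Sum>\<alpha>\<in>Poly_Mapping.keys M. Poly_Mapping.map ((*) (coeff_at M \<alpha>)) (res \<alpha>))"

definition weight :: "(exponent \<Rightarrow>\<^sub>0 nat) \<Rightarrow> 'k" where
  "weight = mon (\<lambda>\<alpha>. inverse (of_nat (exp_fact \<alpha>)))"

lemma lookup_pull_exp: "coeff_at (pull_exp M) v = extend (\<lambda>\<alpha>. coeff_at (res \<alpha>) v) M"
  by (simp add: pull_exp_def lookup_sum extend_def del: lookup_exp_restrict)

lemma pull_exp_add: "pull_exp (M + N) = pull_exp M + pull_exp N"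
  by (rule poly_mapping_eqI) (simp only: lookup_pull_exp lookup_add extend_add)

lemma pull_exp_single: "pull_exp (Poly_Mapping.single \<alpha> k) = Poly_Mapping.map ((*) k) (res \<alpha>)"
  by (rule poly_mapping_eqI) (simp add: lookup_pull_exp)

lemma pull_exp_single_1: "pull_exp (Poly_Mapping.single \<alpha> 1) = res \<alpha>"
  by (rule poly_mapping_eqI) (simp add: lookup_pull_exp)

lemma pull_exp_base: "pull_exp (Poly_Mapping.single base_exp k) = 0"
  by (rule poly_mapping_eqI) (simp add: pull_exp_single del: lookup_exp_restrict)

lemma keys_pull_exp: "Poly_Mapping.keys (pull_exp M) \<subseteq> A"
proof
  fix v assume "v \<in> Poly_Mapping.keys (pull_exp M)"
  then show "v \<in> A" by (rule contrapos_pp) (simp add: in_keys_iff lookup_pull_exp extend_def)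
qed

text \<open>Substituting the monomials \<open>res \<alpha>\<close> for the coordinates turns
  \<open>M\<close> into a monomial with exponent \<open>pull_exp M\<close>.\<close>

lemma mon_pull_exp: "mon y (pull_exp M) = mon (\<lambda>\<alpha>. mon y (res \<alpha>)) M"
  by (simp add: pull_exp_def mon_sum mon_map_times mon_def[of _ M])

lemma weight_nonzero: "Poly_Mapping.keys M \<subseteq> W \<Longrightarrow> weight M \<noteq> 0"
  unfolding weight_def using of_nat_exp_fact_nonzero by (intro mon_nonzero) auto

text \<open>Without weights, this is the coefficient at \<gamma> of the derivative of
  \<open>dual\<close> by the pullback of \<open>M\<close>. Degrees are no longer visible in the
  chart, so the index \<open>t\<close> is what makes the resulting ideal homogeneous.\<close>

definition graded_functional :: "nat \<Rightarrow> exponent \<Rightarrow> (exponent \<Rightarrow>\<^sub>0 nat) \<Rightarrow> 'k" where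
  "graded_functional t \<gamma> M =
     (if total_deg M = t then weight M * coeff_at dual (pull_exp M + \<gamma>) else 0)"

text \<open>Multiplication by \<open>N\<close> lowers \<open>t\<close> and shifts \<gamma>. The
  family of all conditions is therefore stable, up to factors, under multiplication by
  monomials.\<close>

lemma graded_functional_add:
  "graded_functional t \<gamma> (N + M) =
     (if total_deg N \<le> t then weight N * graded_functional (t - total_deg N) (\<gamma> + pull_exp N) M else 0)"
  by (auto simp: graded_functional_def total_deg_add pull_exp_add weight_def mon_add add_ac)

lemma extend_graded_functional_add:
  "extend (\<lambda>M. graded_functional t \<gamma> (N + M)) G = (if total_deg N \<le> t then
     weight N * extend (graded_functional (t - total_deg N) (\<gamma> + pull_exp N)) G else 0)"
  by (simp add: graded_functional_add extend_cmult)

text \<open>The condition says that the pullback of each homogeneous component annihilates \<open>dual\<close>: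
  the coefficients of the resulting derivative are indexed by \<open>\<gamma>\<close>.\<close>

definition apolar_ideal :: "(exponent, 'k) mpoly set" where
  "apolar_ideal = {G \<in> poly_ring W. \<forall>t \<gamma>. extend (graded_functional t \<gamma>) G = 0}"

lemma apolar_ideal_mult:
  assumes "G \<in> apolar_ideal" "H \<in> poly_ring W"
  shows "H * G \<in> apolar_ideal"
proof -
  have "extend (\<lambda>q. graded_functional t \<gamma> (l + q)) G = 0" for t \<gamma> l
    using assms(1) by (simp add: extend_graded_functional_add apolar_ideal_def)
  then have "extend (graded_functional t \<gamma>) (H * G) = 0" for t \<gamma>
    unfolding extend_mult by (simp add: extend_def)
  then show ?thesis
    using assms poly_ring_mult[of H W G] by (simp add: apolar_ideal_def)
qed

lemma homogeneous_apolar_ideal: "homogeneous_ideal W apolar_ideal"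
  unfolding homogeneous_ideal_def is_ideal_def
proof (intro conjI ballI allI)
  show "apolar_ideal \<subseteq> poly_ring W" "0 \<in> apolar_ideal"
    by (auto simp: apolar_ideal_def poly_ring_def)
  fix G H assume G: "G \<in> apolar_ideal"
  show "H * G \<in> apolar_ideal" if "H \<in> poly_ring W"
    by (rule apolar_ideal_mult[OF G that])
  show "G + H \<in> apolar_ideal" if H: "H \<in> apolar_ideal"
  proof -
    have "G + H \<in> poly_ring W"
      using G H Poly_Mapping.keys_add[of G H] by (auto simp: apolar_ideal_def poly_ring_def) blast+
    then show ?thesis using G H by (simp add: apolar_ideal_def extend_add)
  qed
  fix u
  have "extend (graded_functional t \<gamma>) (hom_component u G) = 0" for t \<gamma>
  proof (cases "t = u")
    case True
    have "(\<lambda>M. if total_deg M = u then graded_functional t \<gamma> M else 0) = graded_functional t \<gamma>"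
      using True by (auto simp: graded_functional_def)
    then show ?thesis using G by (simp add: extend_hom_component apolar_ideal_def)
  next
    case False
    then have "(\<lambda>M. if total_deg M = u then graded_functional t \<gamma> M else 0) = (\<lambda>M. 0)"
      by (auto simp: graded_functional_def)
    then show ?thesis by (simp add: extend_hom_component)
  qed
  then show "hom_component u G \<in> apolar_ideal"
    using G hom_component_in_poly_ring by (auto simp: apolar_ideal_def)
qed

text \<open>The coordinate with index \<open>base_exp\<close> pulls back to a nonzero constant.\<close>

lemma saturated_apolar_ideal: "saturated W apolar_ideal"
  unfolding saturated_def
proof (intro ballI impI)
  fix G assume G: "G \<in> poly_ring W" and "\<exists>k. \<forall>H\<in>forms W k. H * G \<in> apolar_ideal"
  then obtain k where k: "\<And>H. H \<in> forms W k \<Longrightarrow> H * G \<in> apolar_ideal" by blast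
  let ?N = "Poly_Mapping.single base_exp k"
  have N: "Poly_Mapping.keys ?N \<subseteq> W" using base_exp_in by simp
  have "Poly_Mapping.single ?N 1 \<in> forms W k"
    using N by (simp add: forms_eq_coord_space coord_space_def)
  then have "Poly_Mapping.single ?N 1 * G \<in> apolar_ideal" by (rule k)
  \<comment> \<open>In degree \<open>t + k\<close> the condition on the product is the condition on
    \<open>G\<close> in degree \<open>t\<close>, up to the nonzero factor
    \<open>weight ?N\<close>.\<close>
  then have "extend (graded_functional (t + k) \<gamma>) (Poly_Mapping.single ?N 1 * G) = 0" for t \<gamma>
    by (simp add: apolar_ideal_def)
  then have "weight ?N * extend (graded_functional t \<gamma>) G = 0" for t \<gamma>
    by (simp add: extend_mult extend_graded_functional_add pull_exp_base)
  then show "G \<in> apolar_ideal"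
    using G weight_nonzero[OF N] by (simp add: apolar_ideal_def)
qed


section \<open>The apolar scheme lies on the Segre-Veronese variety and spans the form\<close>

text \<open>A form that vanishes on the variety pulls back to a polynomial that vanishes on the
  whole chart. Over an infinite field this polynomial is zero, so it annihilates
  \<open>dual\<close>.\<close>

lemma vanishing_ideal_subset_apolar_ideal:
  assumes inf: "infinite (UNIV :: 'k set)"
  shows "vanishing_ideal W (segre_veronese s ns ds) \<subseteq> apolar_ideal"
proof
  fix G :: "(exponent, 'k) mpoly"
  assume G: "G \<in> vanishing_ideal W (segre_veronese s ns ds)"
  then have GW: "G \<in> poly_ring W" by (simp add: vanishing_ideal_def)
  have "extend (graded_functional t \<gamma>) G = 0" for t \<gamma>
  proof -
    let ?H = "hom_component t G"
    have keysH: "Poly_Mapping.keys M \<subseteq> W" if "M \<in> Poly_Mapping.keys ?H" for M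
      using hom_component_in_poly_ring[OF GW, of t] that by (auto simp: poly_ring_def)
    have "(\<Sum>M\<in>Poly_Mapping.keys ?H. coeff_at ?H M * weight M * mon y (pull_exp M)) = 0" for y
    proof -
      \<comment> \<open>Setting the coordinates of index 0 to 1 makes the linear forms nonzero and
        places the point in the chart.\<close>
      define y' where "y' = (\<lambda>v. if fst v = 0 then 1 else y v)"
      define l where "l j = linear_form y' (block ns j)" for j
      define p where "p = (\<Prod>j=1..s. divided_power (l j) (ds j))"
      have l: "l j \<in> multiforms s ns (unit_degree j) \<and> l j \<noteq> 0" if j: "j \<in> {1..s}" for j
      proof -
        have "coeff_at (l j) (Poly_Mapping.single (0, j) 1) = 1"
          unfolding l_def by (subst lookup_linear_form) (auto simp: block_def y'_def)
        then have "l j \<noteq> 0" by auto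
        then show ?thesis using linear_form_in_multiforms[OF j] by (simp add: l_def)
      qed
      have coeff_p: "coeff_at p \<alpha> = inverse (of_nat (exp_fact \<alpha>)) * mon y (res \<alpha>)" if \<alpha>: "\<alpha> \<in> W" for \<alpha>
      proof -
        have "of_nat (exp_fact \<alpha>) * coeff_at p \<alpha> = mon y' \<alpha>"
          unfolding p_def l_def
        proof (rule lookup_prod_divided_power)
          fix j assume j: "j \<in> {1..s}"
          have "ds j \<le> (\<Sum>j=1..s. ds j)" using j by (intro member_le_sum) auto
          then show "of_nat (fact (ds j)) \<noteq> (0 :: 'k)"
            using char by (intro of_nat_fact_nonzero) auto
        qed (use \<alpha> total_deg_exp_restrict_block[OF \<alpha>] vars_eq_UN_block[of s ns]
              in \<open>auto simp: monomials_def block_def\<close>)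
        also have "\<dots> = mon y' (res \<alpha>)"
          using \<alpha> by (intro mon_res[symmetric]) (auto simp: y'_def)
        also have "\<dots> = mon y (res \<alpha>)"
          by (rule mon_cong) (auto simp: y'_def mem_affine_vars)
        finally show ?thesis
          using of_nat_exp_fact_nonzero[OF \<alpha>] by (simp add: field_simps)
      qed
      have "proj_point p \<in> segre_veronese s ns ds"
        unfolding segre_veronese_def p_def using l by blast
      moreover have "p \<in> proj_point p"
        by (simp add: proj_point_def lin.span_base)
      ultimately have "eval_at ?H p = 0"
        using G by (auto simp: vanishing_ideal_def)
      moreover have "mon (coeff_at p) M = weight M * mon y (pull_exp M)"
        if "M \<in> Poly_Mapping.keys ?H" for M
      proof -
        have "mon (coeff_at p) M = mon (\<lambda>\<alpha>. inverse (of_nat (exp_fact \<alpha>)) * mon y (res \<alpha>)) M"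
          using keysH[OF that] coeff_p by (intro mon_cong) auto
        then show ?thesis by (simp add: mon_mult weight_def mon_pull_exp)
      qed
      ultimately show ?thesis
        by (simp add: eval_at_eq_extend extend_def mult.assoc)
    qed
    \<comment> \<open>The relation holds for all \<open>y\<close>, hence between formal monomials;
      each may be replaced by the coefficient of \<open>dual\<close> at its exponent shifted by
      \<gamma>.\<close>
    then have "(\<Sum>M\<in>Poly_Mapping.keys ?H. coeff_at ?H M * weight M * coeff_at dual (pull_exp M + \<gamma>)) = 0"
      by (rule monomial_functions_independent[where e = pull_exp and a = "\<lambda>M. coeff_at ?H M * weight M"
          and c = "\<lambda>\<beta>. coeff_at dual (\<beta> + \<gamma>)", OF inf finite_keys finite_affine_vars keys_pull_exp])
    then have "extend (\<lambda>M. weight M * coeff_at dual (pull_exp M + \<gamma>)) ?H = 0"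
      by (simp add: extend_def mult.assoc)
    then show ?thesis
      by (simp add: extend_hom_component graded_functional_def[abs_def])
  qed
  then show "G \<in> apolar_ideal" using GW by (simp add: apolar_ideal_def)
qed

text \<open>If a subspace \<open>U\<close> misses \<open>F\<close>, some hyperplane through
  \<open>U\<close> does too. When the ideal of \<open>U\<close> lies in \<open>apolar_ideal\<close>,
  so does the equation of that hyperplane, which forces it to vanish at \<open>F\<close>.\<close>

lemma proj_point_in_linear_span:
  assumes "F \<noteq> 0"
  shows "proj_point F \<in> linear_span W apolar_ideal"
  unfolding linear_span_def
proof clarify
  fix U :: "(exponent \<Rightarrow>\<^sub>0 'k) set"
  assume U: "U \<subseteq> coord_space W" "lin.subspace U" "vanishing_ideal W (projective_space U) \<subseteq> apolar_ideal"
  have "F \<in> U"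
  proof (rule ccontr)
    assume "F \<notin> U"
    then obtain h where h: "\<And>u. u \<in> U \<Longrightarrow> extend h u = 0" "extend h F = 1"
      using separating_functional[OF U(2)] by blast
    let ?H = "linear_form h W"
    have *: "extend h u = (\<Sum>\<alpha>\<in>W. h \<alpha> * coeff_at u \<alpha>)" if "u \<in> coord_space W" for u
      using that by (subst extend_superset[of W]) (auto simp: coord_space_def mult_ac)
    have "eval_at (hom_component t ?H) u = 0" if P: "P \<in> projective_space U" "u \<in> P" for t P u
    proof -
      obtain w where "w \<in> U" "P = lin.span {w}"
        using P by (auto simp: projective_space_def proj_point_def)
      then have u: "u \<in> U" using P U(2) lin.span_minimal[of "{w}" U] by auto
      have "eval_at (hom_component t ?H) u = (if t = 1 then extend h u else 0)"
        using u U(1) by (auto simp: eval_at_eq_extend extend_hom_component extend_linear_form *)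
      then show ?thesis using h(1)[OF u] by simp
    qed
    then have "?H \<in> vanishing_ideal W (projective_space U)"
      by (simp add: vanishing_ideal_def linear_form_in_poly_ring)
    then have "?H \<in> apolar_ideal" using U(3) by blast
    then have "extend (graded_functional 1 0) ?H = 0" by (simp add: apolar_ideal_def)
    \<comment> \<open>For \<open>t = 1\<close> and \<gamma> = 0 the factorial in \<open>dual\<close>
      cancels against \<open>weight\<close>, so the condition on \<open>?H\<close> becomes
      \<open>extend h F = 0\<close>.\<close>
    moreover have "graded_functional 1 0 (Poly_Mapping.single \<alpha> 1) = coeff_at F \<alpha>" if "\<alpha> \<in> W" for \<alpha>
      using of_nat_exp_fact_nonzero[OF that] lookup_dual[OF that]
      by (simp add: graded_functional_def weight_def pull_exp_single_1[simplified])
    moreover have "F \<in> coord_space W" using F by (simp add: multiforms_def)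
    ultimately show False
      using h(2) by (simp add: extend_linear_form *)
  qed
  then show "proj_point F \<in> projective_space U"
    using assms by (auto simp: projective_space_def)
qed

section \<open>The length of the apolar scheme\<close>

text \<open>The pullback of \<open>G\<close> acting on \<open>dual\<close> as a differential
  operator. Its kernel on the forms of one degree is the part of \<open>apolar_ideal\<close> in that
  degree, so its rank gives the Hilbert function.\<close>

definition pairing :: "(exponent, 'k) mpoly \<Rightarrow> (exponent \<Rightarrow>\<^sub>0 'k)" where
  "pairing G = (\<Sum>M\<in>Poly_Mapping.keys G. scale (coeff_at G M * weight M) (deriv_dual (pull_exp M)))"

lemma lookup_pairing:
  "coeff_at (pairing G) \<gamma> = extend (\<lambda>M. weight M * coeff_at dual (pull_exp M + \<gamma>)) G"
  by (simp add: pairing_def lookup_sum extend_def mult.assoc)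

lemma linear_pairing: "Vector_Spaces.linear scale scale pairing"
  unfolding Vector_Spaces.linear_iff
proof (intro conjI allI)
  show "vector_space (scale :: 'k \<Rightarrow> ('m \<Rightarrow>\<^sub>0 'k) \<Rightarrow> _)" by unfold_locales
  show "vector_space (scale :: 'k \<Rightarrow> ('m \<Rightarrow>\<^sub>0 'k) \<Rightarrow> _)" by unfold_locales
qed (auto intro!: poly_mapping_eqI simp: lookup_pairing lookup_add extend_add extend_scale)

text \<open>On forms of degree \<open>t\<close> only the functionals of that index can be nonzero,
  and their values are the coefficients of \<open>pairing G\<close>.\<close>

lemma apolar_ideal_Int_forms: "apolar_ideal \<inter> forms W t = forms W t \<inter> {G. pairing G = 0}"
proof -
  have "G \<in> apolar_ideal \<longleftrightarrow> pairing G = 0" if G: "G \<in> forms W t" for G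
  proof -
    have "extend (graded_functional u \<gamma>) G = (if u = t then coeff_at (pairing G) \<gamma> else 0)" for u \<gamma>
    proof -
      have "extend (graded_functional u \<gamma>) G =
          extend (\<lambda>M. if u = t then weight M * coeff_at dual (pull_exp M + \<gamma>) else 0) G"
        using G by (intro extend_cong) (auto simp: forms_def graded_functional_def)
      then show ?thesis by (auto simp: lookup_pairing)
    qed
    then show ?thesis
      using G by (auto simp: apolar_ideal_def forms_def poly_mapping_eq_iff fun_eq_iff)
  qed
  then show ?thesis by auto
qed

definition derivs :: "(exponent \<Rightarrow>\<^sub>0 'k) set" where
  "derivs = deriv_dual ` res ` W"

lemma pairing_in_span_derivs: "pairing G \<in> lin.span derivs"
  unfolding pairing_def
proof (intro lin.span_sum lin.span_scale)
  fix M
  show "deriv_dual (pull_exp M) \<in> lin.span derivs"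
  proof (cases "pull_exp M \<in> res ` W")
    case True
    then show ?thesis by (auto simp: derivs_def intro: lin.span_base)
  next
    case False
    then have "deriv_dual (pull_exp M) = 0"
      using res_image_down_closed lookup_dual_eq_0 by (intro poly_mapping_eqI) (metis lookup_deriv_dual lookup_zero)
    then show ?thesis by (simp add: lin.span_zero)
  qed
qed

lemma derivs_subset_pairing_image:
  assumes "t \<ge> 1"
  shows "derivs \<subseteq> pairing ` forms W t"
proof
  fix r assume "r \<in> derivs"
  then obtain \<alpha> where \<alpha>: "\<alpha> \<in> W" "r = deriv_dual (res \<alpha>)" by (auto simp: derivs_def)
  \<comment> \<open>The \<open>t - 1\<close> copies of the base coordinate fill up the degree and
    leave the pullback unchanged.\<close>
  let ?M = "Poly_Mapping.single \<alpha> 1 + Poly_Mapping.single base_exp (t - 1)"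
  let ?G = "Poly_Mapping.single ?M (inverse (weight ?M))"
  have keys: "Poly_Mapping.keys ?M \<subseteq> W" using \<alpha>(1) base_exp_in by (simp add: keys_add_nat)
  have "?G \<in> forms W t"
    using keys assms by (auto simp: forms_eq_coord_space coord_space_def total_deg_add)
  moreover have "pairing ?G = r"
  proof (rule poly_mapping_eqI)
    fix \<gamma>
    show "coeff_at (pairing ?G) \<gamma> = coeff_at r \<gamma>"
      using weight_nonzero[OF keys]
      by (simp add: lookup_pairing \<alpha>(2) pull_exp_add pull_exp_base pull_exp_single_1[simplified])
  qed
  ultimately show "r \<in> pairing ` forms W t" by blast
qed

text \<open>By rank-nullity the value is the dimension of the image of \<open>pairing\<close>, which
  spans the same space as \<open>derivs\<close>. The function is thus constant from degree 1 on, and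
  this constant is the length.\<close>

lemma hilbert_function_apolar_ideal:
  assumes "t \<ge> 1"
  shows "hilbert_function W apolar_ideal t = lin.dim derivs"
proof -
  let ?B = "{M. Poly_Mapping.keys M \<subseteq> W \<and> total_deg M = t}"
  have "finite ?B"
    using finite_card_exponents[OF finite_monomials, of s ns ds t] by (auto elim: rev_finite_subset)
  have "hilbert_function W apolar_ideal t = lin.dim (pairing ` forms W t)"
    unfolding hilbert_function_def apolar_ideal_Int_forms
  proof (rule dim_diff_dim_kernel[OF linear_pairing])
    show "lin.subspace (forms W t :: (exponent, 'k) mpoly set)"
      unfolding forms_eq_coord_space by (rule subspace_coord_space)
    show "forms W t \<subseteq> lin.span ((\<lambda>M. Poly_Mapping.single M (1 :: 'k)) ` ?B)"
      unfolding forms_eq_coord_space by (rule coord_space_subset_span)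
  qed (use \<open>finite ?B\<close> in simp)
  also have "lin.span (pairing ` forms W t) = lin.span derivs"
    using pairing_in_span_derivs derivs_subset_pairing_image[OF assms]
    by (intro subset_antisym lin.span_minimal lin.subspace_span lin.span_mono) auto
  then have "lin.dim (pairing ` forms W t) = lin.dim derivs"
    by (rule lin.span_eq_dim)
  finally show ?thesis .
qed

text \<open>Derivatives of order at most \<open>k\<close> are few; the others have degree at most \<open>e\<close>.\<close>

lemma dim_derivs_le:
  assumes d: "(\<Sum>j=1..s. ds j) \<le> k + e + 1"
  defines "n \<equiv> \<Sum>j=1..s. ns j"
  shows "lin.dim derivs \<le> ((n + k) choose k) + ((n + e) choose e)"
proof -
  let ?E = "\<lambda>k. {m. Poly_Mapping.keys m \<subseteq> A \<and> total_deg m \<le> k}"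
  let ?S = "deriv_dual ` ?E k \<union> (\<lambda>\<gamma>. Poly_Mapping.single \<gamma> 1) ` ?E e"
  have fin: "finite (?E i)" and card: "card (?E i) \<le> (n + i) choose i" for i
    using finite_card_exponents[OF finite_affine_vars, of s ns i] by (auto simp: card_affine_vars n_def)
  have res: "Poly_Mapping.keys \<beta> \<subseteq> A \<and> total_deg \<beta> \<le> k + e + 1" if \<beta>: "\<beta> \<in> res ` W" for \<beta>
  proof -
    obtain \<alpha> where \<alpha>: "\<alpha> \<in> W" "\<beta> = res \<alpha>" using \<beta> by auto
    have "total_deg \<beta> = (\<Sum>v\<in>Poly_Mapping.keys \<alpha>. coeff_at \<beta> v)"
      unfolding \<alpha>(2) by (rule total_deg_superset) auto
    also have "\<dots> \<le> total_deg \<alpha>"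
      unfolding total_deg_def \<alpha>(2) by (intro sum_mono) auto
    finally show ?thesis using total_deg_monomials[OF \<alpha>(1)] d \<alpha>(2) by auto
  qed
  have "derivs \<subseteq> lin.span ?S"
  proof
    fix r assume "r \<in> derivs"
    then obtain \<beta> where \<beta>: "\<beta> \<in> res ` W" "r = deriv_dual \<beta>" unfolding derivs_def by blast
    show "r \<in> lin.span ?S"
    proof (cases "total_deg \<beta> \<le> k")
      case True
      then show ?thesis using \<beta> res[OF \<beta>(1)] by (auto intro!: lin.span_base)
    next
      case False
      \<comment> \<open>The degree of \<beta> is at least \<open>k + 1\<close> and that of \<beta> +
        \<gamma> at most \<open>k + e + 1\<close>.\<close>
      have "\<gamma> \<in> ?E e" if "\<gamma> \<in> Poly_Mapping.keys r" for \<gamma>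
      proof -
        have "\<beta> + \<gamma> \<in> res ` W"
          using that lookup_dual_eq_0[of "\<beta> + \<gamma>"] by (auto simp: \<beta>(2) in_keys_iff)
        then show ?thesis using res[of "\<beta> + \<gamma>"] False by (auto simp: keys_add_nat total_deg_add)
      qed
      then have "r \<in> coord_space (?E e)" by (auto simp: coord_space_def)
      then show ?thesis
        using coord_space_subset_span lin.span_mono[of "(\<lambda>\<gamma>. Poly_Mapping.single \<gamma> 1) ` ?E e" ?S] by blast
    qed
  qed
  then have "lin.dim derivs \<le> card ?S"
    using fin by (intro lin.dim_le_card) auto
  also have "\<dots> \<le> card (?E k) + card (?E e)"
    by (intro order_trans[OF card_Un_le] add_mono card_image_le fin)
  finally show ?thesis using card[of k] card[of e] by linarith
qed

lemma cactus_rank_le_dim_derivs: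
  assumes "infinite (UNIV :: 'k set)" "F \<noteq> 0"
  shows "cactus_rank s ns ds (proj_point F) \<le> enat (lin.dim derivs)"
  unfolding cactus_rank_def
\<comment> \<open>The apolar scheme is one of the competing schemes; the threshold for its Hilbert
  function is degree 1.\<close>
proof (rule Inf_lower, intro CollectI exI conjI)
  show "zero_dim_subscheme W apolar_ideal (lin.dim derivs)"
    unfolding zero_dim_subscheme_def closed_subscheme_def
    using homogeneous_apolar_ideal saturated_apolar_ideal hilbert_function_apolar_ideal by blast
qed (use assms vanishing_ideal_subset_apolar_ideal proj_point_in_linear_span in auto)

end

theorem theorem1p2:
  fixes s n d :: nat and ns ds :: "nat \<Rightarrow> nat"
    and f :: "(exponent, 'k::alg_closed_field) proj_point"
  assumes "s \<ge> 1"
    and "\<And>j. j \<in> {1..s} \<Longrightarrow> ns j \<ge> 1"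
    and "\<And>j. j \<in> {1..s} \<Longrightarrow> ds j \<ge> 1"
    and "n = (\<Sum>j=1..s. ns j)"
    and "d = (\<Sum>j=1..s. ds j)"
    and "CHAR('k) = 0 \<or> CHAR('k) > d"
    and "f \<in> projective_space (multiforms s ns ds)"
  shows "(\<forall>k. d = 2 * k + 2 \<longrightarrow>
            cactus_rank s ns ds f \<le> enat (((n + k) choose k) + ((n + k + 1) choose (k + 1)))) \<and>
         (\<forall>k. d = 2 * k + 1 \<longrightarrow>
            cactus_rank s ns ds f \<le> enat (2 * ((n + k) choose k)))"
proof -
  obtain F :: "(nat \<times> nat, 'k) mpoly" where F_in: "F \<in> multiforms s ns ds" and "F \<noteq> 0" and f: "f = proj_point F"
    using assms(7) by (auto simp: projective_space_def)
  interpret multiform s ns ds F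
    by unfold_locales (use F_in assms(5,6) in auto)
  \<comment> \<open>Both parities are instances: \<open>e = k + 1\<close> for even \<open>d\<close>
    and \<open>e = k\<close> for odd \<open>d\<close>.\<close>
  have rank: "cactus_rank s ns ds f \<le> enat (((n + k) choose k) + ((n + e) choose e))"
    if "d = k + e + 1" for k e
  proof -
    have "lin.dim derivs \<le> ((n + k) choose k) + ((n + e) choose e)"
      using dim_derivs_le[of k e] that assms(4,5) by simp
    then show ?thesis
      using cactus_rank_le_dim_derivs[OF infinite_UNIV_alg_closed \<open>F \<noteq> 0\<close>] f
      by (metis enat_ord_simps(1) order_trans)
  qed
  show ?thesis
  proof (intro conjI allI impI)
    fix k
    show "cactus_rank s ns ds f \<le> enat (((n + k) choose k) + ((n + k + 1) choose (k + 1)))"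
      if "d = 2 * k + 2"
      using rank[of k "k + 1"] that by (simp add: add.assoc)
    show "cactus_rank s ns ds f \<le> enat (2 * ((n + k) choose k))" if "d = 2 * k + 1"
      using rank[of k k] that by (simp add: mult_2)
  qed
qed

end
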